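(* Let $n\ge 1$ be an integer, $\rho\in(0,1)$, $\beta>1/2$, and let $P_0$ be (the CDF of) a probability distribution on $\mathbb{R}$ that is absolutely continuous with respect to Lebesgue measure. Let $(y_{n+k})_{k\ge1}$ and $(P_k)_{k\ge 0}$ be the random sequences generated from $P_0$ by the Gaussian copula forward sampling scheme with parameters $(n,\rho,\beta)$, at a fixed feature value $x$, and let $P_{\infty,x}(y)=\lim_{N\to\infty}P_N(y)$ denote the almost sure limit. Then for any $y\in\mathbb{R}$ and any $\delta\in(0,1)$, the following holds with probability at least $1-\delta$: $$|P_{\infty,x}(y)-P_0(y)|\le\sqrt{\frac{2^{1+2\beta}\log(2/\delta)}{2\beta-1}}\;n^{-\beta+1/2}.$$
   Context: Gaussian copula forward sampling scheme with parameters $(n,\rho,\beta)$ started at $P_0$: $n$ is the size of an observed data set; the data and a feature value $x$ are fixed, so $P_0$ (the initial estimate of the posterior predictive distribution of a label given $x$ and the data) is deterministic; $x$ enters only through $P_0$. For $k=1,2,\dots$, conditionally on $y_{n+1},\dots,y_{n+k-1}$, draw $y_{n+k}\sim P_{k-1}$, and then set, for all $y\in\mathbb{R}$, $$P_k(y)=(1-\alpha_{n+k-1})P_{k-1}(y)+\alpha_{n+k-1}H_\rho\big(P_{k-1}(y),P_{k-1}(y_{n+k})\big),$$ where $P_k$ denotes a (random) CDF on $\mathbb{R}$, the learning rate is $\alpha_i=2^\beta(i+1)^{-\beta}$, and $$H_\rho(u,v)=\Phi\left(\frac{\Phi^{-1}(u)-\rho\,\Phi^{-1}(v)}{\sqrt{1-\rho^2}}\right),$$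 with $\Phi$ the standard normal CDF and conventions $\Phi^{-1}(0)=-\infty$, $\Phi^{-1}(1)=+\infty$, $\Phi(-\infty)=0$, $\Phi(+\infty)=1$ (the values $v\in\{0,1\}$ occur with probability zero and may be ignored). For each fixed $y$, the limit $\lim_{N\to\infty}P_N(y)$ exists almost surely, and defines $P_{\infty,x}(y)$. Probability refers to the randomness of the forward samples $(y_{n+k})_{k\ge1}$. *)

theory Defs
  imports "HOL-Probability.Probability"
begin

text \<open>The standard normal CDF \<open>\<Phi>\<close> and its inverse, with the conventions
  \<open>\<Phi>(-\<infinity>) = 0\<close>, \<open>\<Phi>(\<infinity>) = 1\<close>, \<open>\<Phi>\<^sup>-\<^sup>1(0) = -\<infinity>\<close>, \<open>\<Phi>\<^sup>-\<^sup>1(1) = \<infinity>\<close>.\<close>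

definition std_normal_cdf :: "ereal \<Rightarrow> real" where
  "std_normal_cdf z =
     (case z of ereal x \<Rightarrow> cdf std_normal_distribution x | PInfty \<Rightarrow> 1 | MInfty \<Rightarrow> 0)"

definition std_normal_quantile :: "real \<Rightarrow> ereal" where
  "std_normal_quantile u =
     (if u \<le> 0 then -\<infinity> else if u \<ge> 1 then \<infinity>
      else ereal (THE x. cdf std_normal_distribution x = u))"

definition copula_H :: "real \<Rightarrow> real \<Rightarrow> real \<Rightarrow> real" where
  "copula_H \<rho> u v =
     std_normal_cdf ((std_normal_quantile u - ereal \<rho> * std_normal_quantile v)
                     / ereal (sqrt (1 - \<rho>\<^sup>2)))"

definition learning_rate :: "real \<Rightarrow> nat \<Rightarrow> real" where
  "learning_rate \<beta> i = 2 powr \<beta> * real (i + 1) powr (- \<beta>)"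

text \<open>The sigma-algebra generated by the finite family \<open>(Y i)\<^sub>i\<^sub>\<in>\<^sub>I\<close>
  (trivial if \<open>I = {}\<close>).\<close>

definition generated_by :: "'a measure \<Rightarrow> (nat \<Rightarrow> 'a \<Rightarrow> real) \<Rightarrow> nat set \<Rightarrow> 'a measure" where
  "generated_by M Y I =
     vimage_algebra (space M) (\<lambda>\<omega>. \<lambda>i\<in>I. Y i \<omega>) (Pi\<^sub>M I (\<lambda>_. borel))"

text \<open>\<open>Y i\<close> is the sample \<open>y\<^sub>i\<close> and is constrained only for \<open>i > n\<close>; \<open>P k \<omega>\<close> is the random
  CDF \<open>P\<^sub>k\<close>. The condition \<open>sample\<close> says that the conditional distribution of \<open>y\<^sub>n\<^sub>+\<^sub>k\<close> given
  \<open>y\<^sub>n\<^sub>+\<^sub>1, \<dots>, y\<^sub>n\<^sub>+\<^sub>k\<^sub>-\<^sub>1\<close> has CDF \<open>P\<^sub>k\<^sub>-\<^sub>1\<close>. The fixed feature value enters only through the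
  initial CDF \<open>P0\<close>.\<close>

locale gaussian_copula_forward_sampling = prob_space M
  for M :: "'a measure" +
  fixes n :: nat and \<rho> \<beta> :: real and P0 :: "real \<Rightarrow> real"
    and Y :: "nat \<Rightarrow> 'a \<Rightarrow> real" and P :: "nat \<Rightarrow> 'a \<Rightarrow> real \<Rightarrow> real"
  assumes random_variable_Y: "k \<ge> 1 \<Longrightarrow> random_variable borel (Y (n + k))"
    and initial: "\<omega> \<in> space M \<Longrightarrow> P 0 \<omega> = P0"
    and sample: "k \<ge> 1 \<Longrightarrow>
      AE \<omega> in M. real_cond_exp M (generated_by M Y {n + 1..<n + k})
                   (indicator {\<omega> \<in> space M. Y (n + k) \<omega> \<le> t}) \<omega> = P (k - 1) \<omega> t"
    and update: "k \<ge> 1 \<Longrightarrow> \<omega> \<in> space M \<Longrightarrow>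
      P k \<omega> y = (1 - learning_rate \<beta> (n + k - 1)) * P (k - 1) \<omega> y
        + learning_rate \<beta> (n + k - 1)
            * copula_H \<rho> (P (k - 1) \<omega> y) (P (k - 1) \<omega> (Y (n + k) \<omega>))"

definition limit_cdf :: "(nat \<Rightarrow> 'a \<Rightarrow> real \<Rightarrow> real) \<Rightarrow> 'a \<Rightarrow> real \<Rightarrow> real" where
  "limit_cdf P \<omega> y = lim (\<lambda>N. P N \<omega> y)"

end

theory Submission
  imports Defs "HOL-Real_Asymp.Real_Asymp"
begin

text \<open>
  On a set of full measure every \<open>P\<^sub>k\<close> is monotone and attains every value in \<open>(0, 1)\<close>, so that
  \<open>P\<^sub>k(y\<^sub>n\<^sub>+\<^sub>k\<^sub>+\<^sub>1)\<close> is, given the past, uniformly distributed, i.e. equal to \<open>\<Phi>(Z)\<close> with \<open>Z\<close> standard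
  normal and independent of the past. Since \<open>\<rho> Z + sqrt(1 - \<rho>\<^sup>2) W\<close> is again standard normal for an
  independent standard normal \<open>W\<close>, the mean of \<open>H\<^sub>\<rho>(u, \<Phi>(Z))\<close> is \<open>u\<close>; hence \<open>P\<^sub>k(y)\<close> is a martingale
  with increments bounded by the learning rates. A maximal form of the Azuma inequality,
  applied to all increments, gives the deviation bound uniformly in \<open>N\<close>; applied to the tails, it
  gives almost sure convergence.
\<close>

section \<open>Maximal Azuma inequality\<close>

text \<open>Two obstacles shape the argument. First, \<open>sample\<close> prescribes the
  conditional CDF for each fixed \<open>t\<close> outside a null set that may depend on
  \<open>t\<close>, whereas the update evaluates \<open>P k\<close> at the random point
  \<open>Y (n + Suc k)\<close>; monotonicity and attained values permit the passage from fixed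
  rational \<open>t\<close> to a random point. Second, for \<open>v\<close> equal to 0 or 1 the
  function \<open>copula_H \<rho> u v\<close> is constant in \<open>u\<close> on (0, 1), so a single
  such sample would destroy the attained values; these samples have to be excluded almost surely at
  every step. Values are required to be attained only inside the open interval, since a CDF may or
  may not reach 0 and 1. The maximal form of the inequality is used because one event then controls
  all \<open>P N\<close> at once, and the bound passes to the limit path by path.\<close>

lemma two_power_fact_le: "2 ^ n * fact n \<le> (fact (2 * n) :: real)"
proof (induction n)
  case (Suc n)
  have "2 ^ Suc n * fact (Suc n) = (2 * real n + 2) * (2 ^ n * fact n :: real)"
    by (simp add: algebra_simps)
  also have "\<dots> \<le> (2 * real n + 2) * fact (2 * n)"
    using Suc by (intro mult_left_mono) auto
  also have "\<dots> \<le> (2 * real n + 2) * ((2 * real n + 1) * fact (2 * n))"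
    by (intro mult_left_mono) (auto simp: mult_le_cancel_right1)
  also have "\<dots> = fact (2 * Suc n)"
    by (simp add: algebra_simps)
  finally show ?case .
qed simp

text \<open>Both sides are power series in \<open>x\<^sup>2\<close>, compared term by term; this
  reduces to 2^n n! \<le> (2 n)!. The bound turns the \<open>cosh\<close> left over from the chord
  estimate into a Gaussian factor.\<close>

lemma cosh_le_exp_half_square: "cosh x \<le> exp (x\<^sup>2 / 2)" for x :: real
proof -
  have inj: "strict_mono (\<lambda>n::nat. 2 * n)"
    by (auto intro: strict_monoI)
  have "(\<lambda>n. if even n then x ^ n /\<^sub>R fact n else 0) sums cosh x"
    by (rule cosh_converges)
  then have "(\<lambda>n. x ^ (2 * n) /\<^sub>R fact (2 * n)) sums cosh x"
    by (subst (asm) sums_mono_reindex[OF inj, symmetric]) (auto elim: evenE)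
  moreover have "(\<lambda>n. (x\<^sup>2 / 2) ^ n /\<^sub>R fact n) sums exp (x\<^sup>2 / 2)"
    by (rule exp_converges)
  moreover have "x ^ (2 * n) /\<^sub>R fact (2 * n) \<le> (x\<^sup>2 / 2) ^ n /\<^sub>R fact n" for n
  proof -
    have "x ^ (2 * n) / fact (2 * n) \<le> x ^ (2 * n) / (2 ^ n * fact n)"
      by (intro divide_left_mono two_power_fact_le) (auto simp: power_mult)
    also have "\<dots> = (x\<^sup>2 / 2) ^ n /\<^sub>R fact n"
      by (simp add: power_divide field_simps flip: power_mult)
    finally show ?thesis
      by (simp only: real_scaleR_def divide_inverse_commute)
  qed
  ultimately show ?thesis
    by (rule sums_le[rotated])
qed

text \<open>By convexity the exponential lies below its chord over [-l c, l c]. The chord is split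
  into its value at 0 and a part linear in \<open>d\<close>, because the linear part has conditional
  mean zero for a martingale difference.\<close>

lemma exp_mult_le_chord:
  fixes c d l :: real
  assumes "0 < c" "\<bar>d\<bar> \<le> c"
  shows "exp (l * d) \<le> cosh (l * c) + d * (sinh (l * c) / c)"
proof -
  \<comment> \<open>\<open>t\<close> is the weight for which d = (1 - t) (-c) + t c.\<close>
  define t where "t = (1 + d / c) / 2"
  have t: "0 \<le> t" "t \<le> 1"
    using assms by (auto simp: t_def field_simps)
  have "exp ((1 - t) *\<^sub>R (- (l * c)) + t *\<^sub>R (l * c)) \<le> (1 - t) * exp (- (l * c)) + t * exp (l * c)"
    by (rule convex_onD[OF convex_on_exp[of 1, simplified]]) (use t in auto)
  moreover have "(1 - t) *\<^sub>R (- (l * c)) + t *\<^sub>R (l * c) = l * d"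
    using assms by (simp add: t_def field_simps)
  moreover have "(1 - t) * exp (- (l * c)) + t * exp (l * c) = cosh (l * c) + d * (sinh (l * c) / c)"
    using assms by (simp add: t_def cosh_def sinh_def field_simps)
  ultimately show ?thesis
    by simp
qed

lemma subalgebra_chain:
  assumes "\<And>k. subalgebra (F (Suc k)) (F k)" and "i \<le> (j::nat)"
  shows "subalgebra (F j) (F i)"
  using assms(2)
proof (induction j rule: dec_induct)
  case base
  show ?case by (simp add: subalgebra_def)
next
  case (step j)
  then show ?case
    using assms(1)[of j] by (auto simp: subalgebra_def)
qed

context prob_space
begin

text \<open>Induction peels off the last increment: the exponential of the earlier ones is
  measurable for \<open>F N\<close>, so the linear part of the chord integrates to zero against it
  and only the factor \<open>cosh (l * c N)\<close> remains. The bounds \<open>c k\<close> supply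
  integrability.\<close>

lemma azuma_mgf:
  fixes D :: "nat \<Rightarrow> 'a \<Rightarrow> real" and c :: "nat \<Rightarrow> real"
  assumes sub: "\<And>k. subalgebra M (F k)"
    and filt: "\<And>k. subalgebra (F (Suc k)) (F k)"
    and meas: "\<And>k. D k \<in> borel_measurable (F (Suc k))"
    and c: "\<And>k. 0 < c k"
    and bound: "\<And>k \<omega>. \<omega> \<in> space M \<Longrightarrow> \<bar>D k \<omega>\<bar> \<le> c k"
    and centred: "\<And>k. AE \<omega> in M. real_cond_exp M (F k) (D k) \<omega> = 0"
  shows "expectation (\<lambda>\<omega>. exp (l * (\<Sum>k<N. D k \<omega>))) \<le> exp (l\<^sup>2 * (\<Sum>k<N. (c k)\<^sup>2) / 2)"
proof (induction N)
  case 0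
  then show ?case by (simp add: prob_space)
next
  case (Suc N)
  interpret finite_measure_subalgebra M "F N"
    by standard (rule sub)
  define Z where "Z \<omega> = exp (l * (\<Sum>k<N. D k \<omega>))" for \<omega>
  have D_F: "D k \<in> borel_measurable (F N)" if "k < N" for k
    using measurable_from_subalg[OF subalgebra_chain[of F, OF filt] meas, of "k" N] that by simp
  have Z_F[measurable]: "Z \<in> borel_measurable (F N)"
    unfolding Z_def using D_F by measurable
  have Z_M[measurable]: "Z \<in> borel_measurable M"
    by (rule measurable_from_subalg[OF sub Z_F])
  have D_M[measurable]: "D N \<in> borel_measurable M"
    by (rule measurable_from_subalg[OF sub meas])
  have Z_le: "\<bar>Z \<omega>\<bar> \<le> exp (\<bar>l\<bar> * (\<Sum>k<N. c k))" if "\<omega> \<in> space M" for \<omega>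
  proof -
    have "\<bar>\<Sum>k<N. D k \<omega>\<bar> \<le> (\<Sum>k<N. c k)"
      using bound[OF that] by (intro order_trans[OF sum_abs] sum_mono)
    then have "\<bar>l * (\<Sum>k<N. D k \<omega>)\<bar> \<le> \<bar>l\<bar> * (\<Sum>k<N. c k)"
      by (auto simp: abs_mult intro!: mult_left_mono)
    then show ?thesis
      by (simp add: Z_def)
  qed
  have int_Z: "integrable M Z"
    by (rule integrable_const_bound[where B = "exp (\<bar>l\<bar> * (\<Sum>k<N. c k))"]) (use Z_le in auto)
  have int_ZD: "integrable M (\<lambda>\<omega>. Z \<omega> * D N \<omega>)"
    by (rule integrable_const_bound[where B = "exp (\<bar>l\<bar> * (\<Sum>k<N. c k)) * c N"])
       (use Z_le bound in \<open>auto simp: abs_mult intro!: mult_mono\<close>)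
  have ZD_0: "(\<integral>\<omega>. Z \<omega> * D N \<omega> \<partial>M) = 0"
  proof -
    have "(\<integral>\<omega>. Z \<omega> * D N \<omega> \<partial>M) = (\<integral>\<omega>. Z \<omega> * real_cond_exp M (F N) (D N) \<omega> \<partial>M)"
      by (rule real_cond_exp_intg(2)[symmetric]) (use int_ZD in auto)
    also have "\<dots> = 0"
      by (rule integral_eq_zero_AE) (use centred[of N] in auto)
    finally show ?thesis .
  qed
  let ?C = "cosh (l * c N)" and ?K = "sinh (l * c N) / c N"
  have le: "exp (l * (\<Sum>k<Suc N. D k \<omega>)) \<le> Z \<omega> * ?C + Z \<omega> * D N \<omega> * ?K" if "\<omega> \<in> space M" for \<omega>
  proof -
    have "exp (l * (\<Sum>k<Suc N. D k \<omega>)) = Z \<omega> * exp (l * D N \<omega>)"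
      by (simp add: Z_def ring_distribs exp_add)
    also have "\<dots> \<le> Z \<omega> * (?C + D N \<omega> * ?K)"
      using c[of N] bound[OF that, of N] by (intro mult_left_mono exp_mult_le_chord) (auto simp: Z_def)
    finally show ?thesis
      by (simp add: ring_distribs mult.assoc)
  qed
  have "expectation (\<lambda>\<omega>. exp (l * (\<Sum>k<Suc N. D k \<omega>))) \<le> (\<integral>\<omega>. Z \<omega> * ?C + Z \<omega> * D N \<omega> * ?K \<partial>M)"
  proof (rule integral_mono_AE')
    show "integrable M (\<lambda>\<omega>. Z \<omega> * ?C + Z \<omega> * D N \<omega> * ?K)"
      using int_Z int_ZD by (intro Bochner_Integration.integrable_add integrable_mult_left) auto
    show "AE \<omega> in M. exp (l * (\<Sum>k<Suc N. D k \<omega>)) \<le> Z \<omega> * ?C + Z \<omega> * D N \<omega> * ?K"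
      using le by (rule AE_I2)
    show "AE \<omega> in M. 0 \<le> Z \<omega> * ?C + Z \<omega> * D N \<omega> * ?K"
      using le by (intro AE_I2 order_trans[OF exp_ge_zero])
  qed
  also have "\<dots> = expectation Z * ?C"
    using int_Z int_ZD ZD_0 by simp
  also have "\<dots> \<le> exp (l\<^sup>2 * (\<Sum>k<N. (c k)\<^sup>2) / 2) * exp ((l * c N)\<^sup>2 / 2)"
    using Suc.IH[folded Z_def] cosh_le_exp_half_square[of "l * c N"] cosh_real_nonneg[of "l * c N"]
    by (intro mult_mono) auto
  also have "\<dots> = exp (l\<^sup>2 * (\<Sum>k<Suc N. (c k)\<^sup>2) / 2)"
    by (simp add: exp_add[symmetric] power_mult_distrib ring_distribs add_divide_distrib)
  finally show ?case .
qed

lemma maximal_azuma_upper: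
  fixes D :: "nat \<Rightarrow> 'a \<Rightarrow> real" and c :: "nat \<Rightarrow> real"
  assumes sub: "\<And>k. subalgebra M (F k)"
    and filt: "\<And>k. subalgebra (F (Suc k)) (F k)"
    and meas: "\<And>k. D k \<in> borel_measurable (F (Suc k))"
    and c: "\<And>k. 0 < c k"
    and bound: "\<And>k \<omega>. \<omega> \<in> space M \<Longrightarrow> \<bar>D k \<omega>\<bar> \<le> c k"
    and centred: "\<And>k. AE \<omega> in M. real_cond_exp M (F k) (D k) \<omega> = 0"
    and s: "0 < s" "\<And>N. (\<Sum>k<N. (c k)\<^sup>2) \<le> s" and \<epsilon>: "0 < \<epsilon>"
  shows "prob {\<omega> \<in> space M. \<exists>j. (\<Sum>k<j. D k \<omega>) \<ge> \<epsilon>} \<le> exp (- \<epsilon>\<^sup>2 / (2 * s))"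
proof -
  \<comment> \<open>Stopping the walk when it first reaches \<open>\<epsilon>\<close> turns the maximal inequality into one for the final value.\<close>
  define E where "E i = {\<omega> \<in> space M. \<forall>j\<le>i. (\<Sum>k<j. D k \<omega>) < \<epsilon>}" for i
  define X where "X k \<omega> = indicator (E k) \<omega> * D k \<omega>" for k \<omega>
  have spF: "space (F k) = space M" for k
    using sub by (auto simp: subalgebra_def)
  have D_F: "D k \<in> borel_measurable (F i)" if "k < i" for k i
    using measurable_from_subalg[OF subalgebra_chain[of F, OF filt] meas, of k i] that by simp
  have D_M[measurable]: "D k \<in> borel_measurable M" for k
    by (rule measurable_from_subalg[OF sub meas])
  have sum_F: "(\<lambda>\<omega>. \<Sum>k<j. D k \<omega>) \<in> borel_measurable (F i)" if "j \<le> i" for i j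
    using D_F that by (intro borel_measurable_sum) auto
  have E_F: "E i \<in> sets (F i)" for i
  proof -
    have "(\<Inter>j\<in>{..i}. (\<lambda>\<omega>. \<Sum>k<j. D k \<omega>) -` {..<\<epsilon>} \<inter> space (F i)) \<in> sets (F i)"
      by (rule sets.finite_INT) (auto intro: measurable_sets[OF sum_F])
    moreover have "E i = (\<Inter>j\<in>{..i}. (\<lambda>\<omega>. \<Sum>k<j. D k \<omega>) -` {..<\<epsilon>} \<inter> space (F i))"
      by (auto simp: E_def spF)
    ultimately show ?thesis
      by simp
  qed
  have X_meas: "X k \<in> borel_measurable (F (Suc k))" for k
  proof -
    have "E k \<in> sets (F (Suc k))"
      using E_F filt[of k] by (auto simp: subalgebra_def)
    then show ?thesis
      using meas unfolding X_def by measurable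
  qed
  have X_bound: "\<bar>X k \<omega>\<bar> \<le> c k" if "\<omega> \<in> space M" for k \<omega>
    using bound[OF that] c[of k] by (auto simp: X_def indicator_def)
  \<comment> \<open>\<open>E k\<close> depends only on the first \<open>k\<close> increments, so it
    lies in \<open>F k\<close> and its indicator factors out of the conditional expectation:
    stopping keeps the increments centred.\<close>
  have X_centred: "AE \<omega> in M. real_cond_exp M (F k) (X k) \<omega> = 0" for k
  proof -
    interpret finite_measure_subalgebra M "F k"
      by standard (rule sub)
    have 1: "integrable M (X k)"
      using X_bound measurable_from_subalg[OF sub X_meas]
      by (intro integrable_const_bound[where B = "c k"]) auto
    have "AE \<omega> in M. real_cond_exp M (F k) (X k) \<omega> = indicator (E k) \<omega> * real_cond_exp M (F k) (D k) \<omega>"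
      using 1 unfolding X_def
      by (intro real_cond_exp_mult) (auto intro!: borel_measurable_indicator E_F)
    then show ?thesis
      using centred[of k] by eventually_elim simp
  qed
  have fin: "prob {\<omega> \<in> space M. \<exists>j\<le>N. (\<Sum>k<j. D k \<omega>) \<ge> \<epsilon>} \<le> exp (- \<epsilon>\<^sup>2 / (2 * s))" (is "prob ?A \<le> _") for N
  proof -
    \<comment> \<open>Before the first passage time \<open>j\<close> the increments
      \<open>X k\<close> agree with \<open>D k\<close>, and from \<open>j\<close> on they vanish;
      the stopped sum at \<open>N\<close> retains the value reached at \<open>j\<close>.\<close>
    have T_ge: "(\<Sum>k<N. X k \<omega>) \<ge> \<epsilon>" if \<omega>: "\<omega> \<in> ?A" for \<omega>
    proof -
      let ?Q = "\<lambda>j. (\<Sum>k<j. D k \<omega>) \<ge> \<epsilon>"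
      define j where "j = (LEAST j. ?Q j)"
      obtain i where i: "i \<le> N" "?Q i"
        using \<omega> by auto
      have j: "?Q j" "j \<le> N"
        using LeastI[of ?Q, OF i(2)] Least_le[of ?Q, OF i(2)] i(1) by (auto simp: j_def)
      have nj: "\<not> ?Q i" if "i < j" for i
        using not_less_Least[of i ?Q] that by (simp add: j_def)
      have "(\<Sum>k<N. X k \<omega>) = (\<Sum>k<j. X k \<omega>)"
        using j nj by (intro sum.mono_neutral_right) (auto simp: X_def E_def indicator_def)
      also have "\<dots> = (\<Sum>k<j. D k \<omega>)"
      proof (rule sum.cong[OF refl])
        fix k assume "k \<in> {..<j}"
        then have "\<omega> \<in> E k"
          using nj \<omega> by (auto simp: E_def not_le[symmetric])
        then show "X k \<omega> = D k \<omega>"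
          by (simp add: X_def)
      qed
      finally show ?thesis
        using j by simp
    qed
    \<comment> \<open>This choice minimises l^2 s / 2 - l \<epsilon>; the minimum is -\<epsilon>^2 /
      (2 s).\<close>
    define l where "l = \<epsilon> / s"
    have l: "0 < l"
      using \<epsilon> s by (simp add: l_def)
    have X_M[measurable]: "X k \<in> borel_measurable M" for k
      by (rule measurable_from_subalg[OF sub X_meas])
    have int: "integrable M (\<lambda>\<omega>. exp (l * (\<Sum>k<N. X k \<omega>)))"
    proof (rule integrable_const_bound[where B = "exp (l * (\<Sum>k<N. c k))"])
      show "AE \<omega> in M. norm (exp (l * (\<Sum>k<N. X k \<omega>))) \<le> exp (l * (\<Sum>k<N. c k))"
      proof (rule AE_I2)
        fix \<omega> assume \<omega>: "\<omega> \<in> space M"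
        have "(\<Sum>k<N. X k \<omega>) \<le> (\<Sum>k<N. c k)"
          using X_bound[OF \<omega>] by (intro sum_mono) (auto simp: abs_le_iff)
        then show "norm (exp (l * (\<Sum>k<N. X k \<omega>))) \<le> exp (l * (\<Sum>k<N. c k))"
          using l by simp
      qed
    qed simp
    have "prob ?A \<le> prob {\<omega> \<in> space M. exp (l * (\<Sum>k<N. X k \<omega>)) \<ge> exp (l * \<epsilon>)}"
      using T_ge l by (intro finite_measure_mono) auto
    also have "\<dots> \<le> (\<integral>\<omega>. exp (l * (\<Sum>k<N. X k \<omega>)) \<partial>M) / exp (l * \<epsilon>)"
      by (rule integral_Markov_inequality_measure[where A = "{}"]) (use int in auto)
    also have "\<dots> \<le> exp (l\<^sup>2 * (\<Sum>k<N. (c k)\<^sup>2) / 2) / exp (l * \<epsilon>)"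
      by (intro divide_right_mono azuma_mgf[of F, OF sub filt X_meas c X_bound X_centred]) auto
    also have "\<dots> \<le> exp (l\<^sup>2 * s / 2) / exp (l * \<epsilon>)"
      using s by (intro divide_right_mono) (auto intro!: mult_left_mono)
    also have "\<dots> = exp (- \<epsilon>\<^sup>2 / (2 * s))"
      using s by (simp add: exp_diff[symmetric] l_def power2_eq_square field_simps)
    finally show ?thesis .
  qed
  \<comment> \<open>The bound \<open>fin\<close> is the same for every horizon \<open>N\<close>, so
    continuity from below removes the horizon.\<close>
  have "(\<lambda>N. prob {\<omega> \<in> space M. \<exists>j\<le>N. (\<Sum>k<j. D k \<omega>) \<ge> \<epsilon>})
      \<longlonglongrightarrow> prob (\<Union>N. {\<omega> \<in> space M. \<exists>j\<le>N. (\<Sum>k<j. D k \<omega>) \<ge> \<epsilon>})"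
    by (rule finite_Lim_measure_incseq) (auto simp: incseq_def intro: order_trans)
  also have "(\<Union>N. {\<omega> \<in> space M. \<exists>j\<le>N. (\<Sum>k<j. D k \<omega>) \<ge> \<epsilon>}) = {\<omega> \<in> space M. \<exists>j. (\<Sum>k<j. D k \<omega>) \<ge> \<epsilon>}"
    by auto
  finally show ?thesis
    by (rule LIMSEQ_le_const2) (use fin in auto)
qed

text \<open>The one-sided bound is applied to \<open>D\<close> and to \<open>- D\<close>; the union
  bound produces the factor 2 that reappears in \<open>ln (2 / \<delta>)\<close>.\<close>

lemma maximal_azuma:
  fixes D :: "nat \<Rightarrow> 'a \<Rightarrow> real" and c :: "nat \<Rightarrow> real"
  assumes sub: "\<And>k. subalgebra M (F k)"
    and filt: "\<And>k. subalgebra (F (Suc k)) (F k)"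
    and meas: "\<And>k. D k \<in> borel_measurable (F (Suc k))"
    and c: "\<And>k. 0 < c k"
    and bound: "\<And>k \<omega>. \<omega> \<in> space M \<Longrightarrow> \<bar>D k \<omega>\<bar> \<le> c k"
    and centred: "\<And>k. AE \<omega> in M. real_cond_exp M (F k) (D k) \<omega> = 0"
    and s: "0 < s" "\<And>N. (\<Sum>k<N. (c k)\<^sup>2) \<le> s" and \<epsilon>: "0 < \<epsilon>"
  shows "prob {\<omega> \<in> space M. \<exists>j. \<bar>\<Sum>k<j. D k \<omega>\<bar> \<ge> \<epsilon>} \<le> 2 * exp (- \<epsilon>\<^sup>2 / (2 * s))"
proof -
  have D_M[measurable]: "D k \<in> borel_measurable M" for k
    by (rule measurable_from_subalg[OF sub meas])
  have D_int: "integrable M (D k)" for k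
    using bound by (intro integrable_const_bound[where B = "c k"]) auto
  have neg: "AE \<omega> in M. real_cond_exp M (F k) (\<lambda>\<omega>. - D k \<omega>) \<omega> = 0" for k
  proof -
    interpret finite_measure_subalgebra M "F k"
      by standard (rule sub)
    have "AE \<omega> in M. real_cond_exp M (F k) (\<lambda>\<omega>. (- 1) * D k \<omega>) \<omega> = (- 1) * real_cond_exp M (F k) (D k) \<omega>"
      by (rule real_cond_exp_cmult[OF D_int])
    then show ?thesis
      using centred[of k] by eventually_elim simp
  qed
  let ?A = "{\<omega> \<in> space M. \<exists>j. (\<Sum>k<j. D k \<omega>) \<ge> \<epsilon>}"
  let ?B = "{\<omega> \<in> space M. \<exists>j. (\<Sum>k<j. - D k \<omega>) \<ge> \<epsilon>}"
  have "prob {\<omega> \<in> space M. \<exists>j. \<bar>\<Sum>k<j. D k \<omega>\<bar> \<ge> \<epsilon>} \<le> prob (?A \<union> ?B)"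
    by (intro finite_measure_mono) (auto simp: sum_negf abs_if split: if_splits)
  also have "\<dots> \<le> prob ?A + prob ?B"
    by (intro measure_Un_le) auto
  also have "prob ?A \<le> exp (- \<epsilon>\<^sup>2 / (2 * s))"
    by (rule maximal_azuma_upper[of F, OF sub filt meas c bound centred s \<epsilon>])
  also have "prob ?B \<le> exp (- \<epsilon>\<^sup>2 / (2 * s))"
    using meas bound by (intro maximal_azuma_upper[of F, OF sub filt _ c _ neg s \<epsilon>]) auto
  finally show ?thesis
    by simp
qed

text \<open>The walk restarted at \<open>m\<close> has squared bounds summing to the tail
  \<open>s m\<close>, which tends to 0. Hence the probability that it ever moves by
  \<open>\<epsilon>\<close> after time \<open>m\<close> tends to 0, and almost every path is
  Cauchy.\<close>

lemma AE_convergent_bounded_martingale_differences: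
  fixes D :: "nat \<Rightarrow> 'a \<Rightarrow> real" and c :: "nat \<Rightarrow> real"
  assumes sub: "\<And>k. subalgebra M (F k)"
    and filt: "\<And>k. subalgebra (F (Suc k)) (F k)"
    and meas: "\<And>k. D k \<in> borel_measurable (F (Suc k))"
    and c: "\<And>k. 0 < c k"
    and bound: "\<And>k \<omega>. \<omega> \<in> space M \<Longrightarrow> \<bar>D k \<omega>\<bar> \<le> c k"
    and centred: "\<And>k. AE \<omega> in M. real_cond_exp M (F k) (D k) \<omega> = 0"
    and summ: "summable (\<lambda>k. (c k)\<^sup>2)"
  shows "AE \<omega> in M. convergent (\<lambda>N. \<Sum>k<N. D k \<omega>)"
proof -
  have D_M[measurable]: "D k \<in> borel_measurable M" for k
    by (rule measurable_from_subalg[OF sub meas])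
  define s where "s m = (\<Sum>k. (c (k + m))\<^sup>2)" for m
  have summ': "summable (\<lambda>k. (c (k + m))\<^sup>2)" for m
    using summ by (rule summable_ignore_initial_segment)
  have s_pos: "0 < s m" for m
    unfolding s_def by (rule suminf_pos[OF summ']) (use c in \<open>simp add: less_imp_neq[symmetric]\<close>)
  have s_0: "s \<longlonglongrightarrow> 0"
    unfolding s_def by (rule suminf_exist_split2[OF summ])
  have osc: "AE \<omega> in M. \<exists>m. \<forall>j. \<bar>\<Sum>k<j. D (k + m) \<omega>\<bar> < \<epsilon>" if \<epsilon>: "0 < \<epsilon>" for \<epsilon> :: real
  proof -
    \<comment> \<open>\<open>?B\<close> is contained in the excursion event of each
      \<open>m\<close>, so all these bounds apply to it and their limit forces probability
      0.\<close>
    let ?B = "{\<omega> \<in> space M. \<forall>m. \<exists>j. \<bar>\<Sum>k<j. D (k + m) \<omega>\<bar> \<ge> \<epsilon>}"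
    have "prob ?B \<le> 2 * exp (- \<epsilon>\<^sup>2 / (2 * s m))" for m
    proof -
      have "prob ?B \<le> prob {\<omega> \<in> space M. \<exists>j. \<bar>\<Sum>k<j. D (k + m) \<omega>\<bar> \<ge> \<epsilon>}"
        by (intro finite_measure_mono) auto
      also have "\<dots> \<le> 2 * exp (- \<epsilon>\<^sup>2 / (2 * s m))"
        by (rule maximal_azuma[where F = "\<lambda>k. F (k + m)" and c = "\<lambda>k. c (k + m)"])
           (use sub filt meas c bound centred s_pos \<epsilon> sum_le_suminf[OF summ'] in \<open>auto simp: s_def\<close>)
      finally show ?thesis .
    qed
    moreover have "(\<lambda>m. 2 * exp (- \<epsilon>\<^sup>2 / (2 * s m))) \<longlonglongrightarrow> 2 * 0"
    proof (intro tendsto_mult tendsto_const filterlim_compose[OF exp_at_bot])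
      have "filterlim (\<lambda>m. \<epsilon>\<^sup>2 / (2 * s m)) at_top sequentially"
        using s_pos \<epsilon> tendsto_mult[OF tendsto_const[of 2] s_0]
        by (intro LIM_at_top_divide[OF tendsto_const]) auto
      then show "filterlim (\<lambda>m. - \<epsilon>\<^sup>2 / (2 * s m)) at_bot sequentially"
        by (simp add: filterlim_uminus_at_top)
    qed
    ultimately have "prob ?B \<le> 2 * 0"
      by (intro LIMSEQ_le_const) blast+
    then have "prob ?B = 0"
      using measure_nonneg[of M ?B] by linarith
    then have "?B \<in> null_sets M"
      by (intro null_setsI) (auto simp: emeasure_eq_measure)
    then show ?thesis
      by (rule AE_I') (auto simp: not_less)
  qed
  \<comment> \<open>The radii 1 / (r + 1) suffice for the Cauchy property, and countably many null
    sets have a null union.\<close>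
  have "AE \<omega> in M. \<forall>r. \<exists>m. \<forall>j. \<bar>\<Sum>k<j. D (k + m) \<omega>\<bar> < inverse (real (Suc r))"
    unfolding AE_all_countable by (intro allI osc) auto
  then show ?thesis
  proof eventually_elim
    case (elim \<omega>)
    have shift: "(\<Sum>k<j + m. D k \<omega>) - (\<Sum>k<m. D k \<omega>) = (\<Sum>k<j. D (k + m) \<omega>)" for j m
      by (induction j) auto
    have "Cauchy (\<lambda>N. \<Sum>k<N. D k \<omega>)"
    proof (rule metric_CauchyI)
      fix e :: real assume "0 < e"
      then obtain r where r: "inverse (real (Suc r)) < e / 2"
        using reals_Archimedean[of "e / 2"] by auto
      obtain m where m: "\<And>j. \<bar>\<Sum>k<j. D (k + m) \<omega>\<bar> < inverse (real (Suc r))"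
        using elim by blast
      have near: "\<bar>(\<Sum>k<i. D k \<omega>) - (\<Sum>k<m. D k \<omega>)\<bar> < e / 2" if "m \<le> i" for i
        using m[of "i - m"] shift[of "i - m" m] that r by simp
      show "\<exists>M. \<forall>i\<ge>M. \<forall>j\<ge>M. dist (\<Sum>k<i. D k \<omega>) (\<Sum>k<j. D k \<omega>) < e"
      proof (intro exI allI impI)
        fix i j assume "m \<le> i" "m \<le> j"
        then show "dist (\<Sum>k<i. D k \<omega>) (\<Sum>k<j. D k \<omega>) < e"
          using near[of i] near[of j] unfolding dist_real_def by linarith
      qed
    qed
    then show ?case
      by (simp add: Cauchy_convergent_iff)
  qed
qed

end

section \<open>The normal distribution function and the copula\<close>

abbreviation Phi :: "real \<Rightarrow> real" where
  "Phi \<equiv> cdf std_normal_distribution"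

interpretation std_normal: real_distribution std_normal_distribution
  by (rule real_dist_normal_dist)

text \<open>A single point is Lebesgue null, so the law has no atoms. This serves both the standard
  normal law and the initial distribution.\<close>

lemma isCont_cdf_absolutely_continuous:
  assumes "real_distribution \<mu>" "absolutely_continuous lborel \<mu>"
  shows "isCont (cdf \<mu>) x"
proof -
  interpret real_distribution \<mu> by fact
  have "{x} \<in> null_sets \<mu>"
    using assms(2) finite_imp_null_set_lborel[of "{x}"] by (auto simp: absolutely_continuous_def)
  then show ?thesis
    by (simp add: isCont_cdf measure_eq_0_null_sets)
qed

lemma isCont_Phi: "isCont Phi x"
  by (intro isCont_cdf_absolutely_continuous real_dist_normal_dist absolutely_continuousI_density) simp

text \<open>The density is positive everywhere, so an interval of mass zero would be Lebesgue null.
  Strictness makes the description in \<open>std_normal_quantile\<close> unique.\<close>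

lemma strict_mono_Phi: "strict_mono Phi"
proof (rule strict_monoI)
  fix x y :: real assume xy: "x < y"
  have "emeasure std_normal_distribution {x<..y} \<noteq> 0"
  proof
    assume "emeasure std_normal_distribution {x<..y} = 0"
    then have "AE t in lborel. t \<notin> {x<..y}"
      by (simp add: emeasure_density nn_integral_0_iff_AE indicator_def not_le[symmetric]
            std_normal_density_def split: if_splits)
    then have "{x<..y} \<in> null_sets lborel"
      by (subst AE_iff_null_sets) auto
    then have "emeasure lborel {x<..y} = 0"
      by (rule null_setsD1)
    then show False
      using xy by simp
  qed
  then have "0 < measure std_normal_distribution {x<..y}"
    by (simp add: std_normal.emeasure_eq_measure zero_less_measure_iff)
  then show "Phi x < Phi y"
    using std_normal.cdf_diff_eq[OF xy] by simp
qed

lemma Phi_less_iff: "Phi x < Phi y \<longleftrightarrow> x < y"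
  and Phi_le_iff: "Phi x \<le> Phi y \<longleftrightarrow> x \<le> y"
  by (simp_all add: strict_mono_less strict_mono_less_eq strict_mono_Phi)

lemma Phi_pos: "0 < Phi x" and Phi_less_1: "Phi x < 1"
  using Phi_less_iff[of "x - 1" x] Phi_less_iff[of x "x + 1"]
    std_normal.cdf_nonneg[of "x - 1"] std_normal.cdf_bounded_prob[of "x + 1"] by linarith+

lemma surj_onto_unit_interval:
  fixes f :: "real \<Rightarrow> real"
  assumes "\<And>x. isCont f x" "(f \<longlongrightarrow> 0) at_bot" "(f \<longlongrightarrow> 1) at_top"
  shows "{0<..<1} \<subseteq> range f"
proof
  fix u :: real assume u: "u \<in> {0<..<1}"
  \<comment> \<open>The sign conditions on \<open>a\<close> and later on \<open>b\<close> ensure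
    \<open>a \<le> b\<close> for the intermediate value theorem.\<close>
  have "\<forall>\<^sub>F x in at_bot. f x < u \<and> x \<le> 0"
    using order_tendstoD(2)[OF assms(2)] u by (intro eventually_conj eventually_le_at_bot) auto
  then obtain a where a: "f a < u" "a \<le> 0"
    using eventually_happens'[OF trivial_limit_at_bot_linorder] by blast
  have "\<forall>\<^sub>F x in at_top. u < f x \<and> 0 \<le> x"
    using order_tendstoD(1)[OF assms(3)] u by (intro eventually_conj eventually_ge_at_top) auto
  then obtain b where b: "u < f b" "0 \<le> b"
    using eventually_happens'[OF trivial_limit_at_top_linorder] by blast
  show "u \<in> range f"
    using IVT[of f a u b] a b assms(1) by auto
qed

lemma Phi_surj:
  assumes "0 < u" "u < 1"
  obtains x where "Phi x = u"
  using surj_onto_unit_interval[OF isCont_Phi std_normal.cdf_lim_at_bot std_normal.cdf_lim_at_top_prob] assms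
  by auto

lemma std_normal_quantile_Phi [simp]: "std_normal_quantile (Phi x) = ereal x"
proof -
  have "(THE z. Phi z = Phi x) = x"
    using strict_mono_eq[OF strict_mono_Phi] by (intro the_equality) auto
  then show ?thesis
    using Phi_pos[of x] Phi_less_1[of x] by (simp add: std_normal_quantile_def)
qed

lemma std_normal_quantile_0 [simp]: "std_normal_quantile 0 = -\<infinity>"
  and std_normal_quantile_1 [simp]: "std_normal_quantile 1 = \<infinity>"
  by (simp_all add: std_normal_quantile_def)

text \<open>Galois connection between CDF and quantile; the conventions at and beyond 0 and 1 make
  it valid for every real \<open>u\<close>. Preimages of half-lines become half-lines, which yields
  measurability.\<close>

lemma std_normal_quantile_le_iff: "std_normal_quantile u \<le> ereal x \<longleftrightarrow> u \<le> Phi x"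
proof -
  consider "u \<le> 0" | "1 \<le> u" | z where "u = Phi z"
    by (metis Phi_surj not_le)
  then show ?thesis
  proof cases
    case 1
    then show ?thesis
      using Phi_pos[of x] by (simp add: std_normal_quantile_def)
  next
    case 2
    then show ?thesis
      using Phi_less_1[of x] by (simp add: std_normal_quantile_def)
  next
    case 3
    then show ?thesis
      by (simp add: Phi_le_iff)
  qed
qed

lemma borel_measurable_std_normal_quantile [measurable]: "std_normal_quantile \<in> borel_measurable borel"
proof (subst borel_measurable_iff_Iic_ereal, intro allI)
  fix a :: ereal
  show "std_normal_quantile -` {..a} \<inter> space borel \<in> sets borel"
  proof (cases a)
    case (real x)
    then have "std_normal_quantile -` {..a} = {..Phi x}"
      by (auto simp: std_normal_quantile_le_iff)
    then show ?thesis
      by simp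
  next
    case PInf
    then have "std_normal_quantile -` {..a} = UNIV"
      by auto
    then show ?thesis
      by simp
  next
    case MInf
    then have "std_normal_quantile -` {..a} = {..0}"
      by (auto simp: std_normal_quantile_def split: if_splits)
    then show ?thesis
      by simp
  qed
qed

lemma borel_measurable_std_normal_cdf [measurable]: "std_normal_cdf \<in> borel_measurable borel"
proof -
  have [measurable]: "Phi \<in> borel_measurable borel"
    by (intro borel_measurable_mono strict_mono_mono strict_mono_Phi)
  have "std_normal_cdf = (\<lambda>z. if z = \<infinity> then 1 else if z = -\<infinity> then 0 else Phi (real_of_ereal z))"
    by (auto simp: std_normal_cdf_def fun_eq_iff split: ereal.split)
  moreover have "\<dots> \<in> borel_measurable borel"
    by measurable
  ultimately show ?thesis
    by simp
qed

section \<open>Measurability, range, monotonicity and mean of the copula transform\<close>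

lemma borel_measurable_copula_H [measurable (raw)]:
  assumes "f \<in> borel_measurable N" "g \<in> borel_measurable N"
  shows "(\<lambda>x. copula_H \<rho> (f x) (g x)) \<in> borel_measurable N"
  unfolding copula_H_def
  by (intro measurable_compose[OF _ borel_measurable_std_normal_cdf] borel_measurable_ereal_divide
      borel_measurable_ereal_diff borel_measurable_ereal_times borel_measurable_const
      measurable_compose[OF _ borel_measurable_std_normal_quantile] assms)

lemma copula_H_nonneg: "0 \<le> copula_H \<rho> u v" and copula_H_le_1: "copula_H \<rho> u v \<le> 1"
  using Phi_pos Phi_less_1
  by (auto simp: copula_H_def std_normal_cdf_def less_imp_le split: ereal.split)

text \<open>Writing the second argument as \<open>Phi z\<close> confines it to (0, 1): its quantile
  is finite, and no difference of two infinities arises.\<close>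

lemma copula_H_0_1:
  assumes "\<bar>\<rho>\<bar> < 1"
  shows "copula_H \<rho> 0 (Phi z) = 0" "copula_H \<rho> 1 (Phi z) = 1"
proof -
  have "0 < sqrt (1 - \<rho>\<^sup>2)"
    using assms by (simp add: abs_square_less_1)
  then show "copula_H \<rho> 0 (Phi z) = 0" "copula_H \<rho> 1 (Phi z) = 1"
    by (auto simp: copula_H_def std_normal_cdf_def)
qed

lemma copula_H_Phi:
  assumes "\<bar>\<rho>\<bar> < 1"
  shows "copula_H \<rho> (Phi a) (Phi z) = Phi ((a - \<rho> * z) / sqrt (1 - \<rho>\<^sup>2))"
proof -
  have "0 < sqrt (1 - \<rho>\<^sup>2)"
    using assms by (simp add: abs_square_less_1)
  then show ?thesis
    by (simp add: copula_H_def std_normal_cdf_def)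
qed

lemma copula_H_mono:
  assumes "\<bar>\<rho>\<bar> < 1" "0 \<le> u" "u \<le> u'" "u' \<le> 1"
  shows "copula_H \<rho> u (Phi z) \<le> copula_H \<rho> u' (Phi z)"
proof -
  have s: "0 < sqrt (1 - \<rho>\<^sup>2)"
    using assms by (simp add: abs_square_less_1)
  consider "u = 0" | "u' = 1" | a b where "u = Phi a" "u' = Phi b"
    using assms by (metis Phi_surj antisym_conv2 less_le_trans le_less_trans)
  then show ?thesis
    by cases (use s assms in \<open>auto simp: copula_H_0_1 copula_H_nonneg copula_H_le_1 copula_H_Phi Phi_le_iff divide_le_cancel\<close>)
qed

text \<open>The integrand is the conditional probability of \<rho> Z + s W \<le> a given Z = z.
  Fubini on the product of two standard normal laws, with the coordinates as Z and W, identifies the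
  integral with the CDF of the sum at \<open>a\<close>;
  \<open>s\<^sup>2 = 1 - \<rho>\<^sup>2\<close> gives the sum variance 1.\<close>

lemma integral_Phi_affine:
  assumes "0 < \<rho>" "\<rho> < 1"
  shows "(\<integral>z. Phi ((a - \<rho> * z) / sqrt (1 - \<rho>\<^sup>2)) \<partial>std_normal_distribution) = Phi a"
proof -
  let ?N = std_normal_distribution
  define s where "s = sqrt (1 - \<rho>\<^sup>2)"
  have s: "0 < s" "s\<^sup>2 = 1 - \<rho>\<^sup>2"
    using assms by (auto simp: s_def abs_square_less_1 power_le_one)
  interpret pair: pair_prob_space ?N ?N ..
  have fst: "distr (?N \<Otimes>\<^sub>M ?N) ?N fst = ?N"
    by (rule std_normal.distr_pair_fst)
  have snd: "distr (?N \<Otimes>\<^sub>M ?N) ?N snd = ?N"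
  proof (rule measure_eqI)
    fix A assume "A \<in> sets (distr (?N \<Otimes>\<^sub>M ?N) ?N snd)"
    then have A: "A \<in> sets ?N" by simp
    have "snd -` A \<inter> space (?N \<Otimes>\<^sub>M ?N) = space ?N \<times> A"
      using sets.sets_into_space[OF A] by (auto simp: space_pair_measure)
    then show "emeasure (distr (?N \<Otimes>\<^sub>M ?N) ?N snd) A = emeasure ?N A"
      using A std_normal.emeasure_space_1 by (simp add: emeasure_distr std_normal.emeasure_pair_measure_Times)
  qed simp
  \<comment> \<open>\<open>distr\<close> sees only the measurable sets of its target, which coincide
    here; this reconciles independence, stated over \<open>borel\<close>, with densities, stated
    over \<open>lborel\<close>.\<close>
  have cong: "distr (?N \<Otimes>\<^sub>M ?N) lborel f = distr (?N \<Otimes>\<^sub>M ?N) ?N f"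
      "distr (?N \<Otimes>\<^sub>M ?N) borel f = distr (?N \<Otimes>\<^sub>M ?N) ?N f" for f
    by (auto intro: distr_cong)
  have indep: "pair.indep_var borel fst borel snd"
    unfolding pair.indep_var_distribution_eq cong fst snd
    by (auto simp: measurable_fst' measurable_snd' intro!: distr_id2[symmetric] sets_pair_measure_cong)
  have fst_snd: "distributed (?N \<Otimes>\<^sub>M ?N) lborel fst (normal_density 0 1)"
      "distributed (?N \<Otimes>\<^sub>M ?N) lborel snd (normal_density 0 1)"
    by (auto simp: distributed_def cong fst snd)
  have X: "distributed (?N \<Otimes>\<^sub>M ?N) lborel (\<lambda>x. 0 + \<rho> * fst x) (normal_density (0 + \<rho> * 0) (\<bar>\<rho>\<bar> * 1))"
    using assms by (intro pair.normal_density_affine fst_snd) auto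
  have Y: "distributed (?N \<Otimes>\<^sub>M ?N) lborel (\<lambda>x. 0 + s * snd x) (normal_density (0 + s * 0) (\<bar>s\<bar> * 1))"
    using s by (intro pair.normal_density_affine fst_snd) auto
  have "distributed (?N \<Otimes>\<^sub>M ?N) lborel (\<lambda>x. \<rho> * fst x + s * snd x) (normal_density (0 + 0) (sqrt (\<rho>\<^sup>2 + s\<^sup>2)))"
  proof (rule pair.add_indep_normal)
    show "pair.indep_var borel (\<lambda>x. \<rho> * fst x) borel (\<lambda>x. s * snd x)"
      by (rule pair.indep_var_compose[unfolded comp_def, OF indep]) auto
  qed (use X Y assms s in auto)
  then have sum: "distr (?N \<Otimes>\<^sub>M ?N) lborel (\<lambda>x. \<rho> * fst x + s * snd x) = ?N"
    using s by (simp add: distributed_def)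
  have "Phi a = (\<integral>x. indicat_real {..a} x \<partial>?N)"
    by (simp add: cdf_def)
  also have "\<dots> = (\<integral>x. indicat_real {..a} x \<partial>distr (?N \<Otimes>\<^sub>M ?N) lborel (\<lambda>x. \<rho> * fst x + s * snd x))"
    unfolding sum ..
  also have "\<dots> = (\<integral>x. indicat_real {..a} (\<rho> * fst x + s * snd x) \<partial>(?N \<Otimes>\<^sub>M ?N))"
    by (rule integral_distr) auto
  also have "\<dots> = (\<integral>z. \<integral>w. indicat_real {..a} (\<rho> * z + s * w) \<partial>?N \<partial>?N)"
    by (subst pair.integral_fst'[symmetric])
       (auto intro!: pair.integrable_const_bound[where B = 1] simp: indicator_def)
  also have "\<dots> = (\<integral>z. Phi ((a - \<rho> * z) / s) \<partial>?N)"
  proof (rule Bochner_Integration.integral_cong[OF refl])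
    fix z
    have "(\<integral>w. indicat_real {..a} (\<rho> * z + s * w) \<partial>?N) = (\<integral>w. indicat_real {..(a - \<rho> * z) / s} w \<partial>?N)"
      using s by (intro Bochner_Integration.integral_cong) (auto simp: indicator_def field_simps)
    then show "(\<integral>w. indicat_real {..a} (\<rho> * z + s * w) \<partial>?N) = Phi ((a - \<rho> * z) / s)"
      by (simp add: cdf_def)
  qed
  finally show ?thesis
    by (simp add: s_def)
qed

text \<open>The endpoints are treated apart because a CDF may take the values 0 and 1 at the chosen
  point, where no representation \<open>Phi a\<close> exists.\<close>

lemma integral_copula_H:
  assumes "0 < \<rho>" "\<rho> < 1" "0 \<le> u" "u \<le> 1"
  shows "(\<integral>z. copula_H \<rho> u (Phi z) \<partial>std_normal_distribution) = u"
proof -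
  consider "u = 0" | "u = 1" | a where "u = Phi a"
    using assms by (metis Phi_surj antisym_conv2)
  then show ?thesis
    using assms
    by cases (auto simp: copula_H_0_1 copula_H_Phi integral_Phi_affine std_normal.prob_space[simplified])
qed

section \<open>Conditional probability integral transform\<close>

context prob_space
begin

text \<open>For a deterministic continuous CDF one would invert it at \<open>v\<close>; here that
  threshold would be random, while \<open>cond\<close> speaks of fixed \<open>t\<close>. Finite sets
  of thresholds involve finitely many null sets, and dominated convergence then lets these sets
  grow. Allowing an arbitrary event \<open>A\<close> of \<open>F\<close> gives independence from
  \<open>F\<close> on top of the uniform law.\<close>

lemma conditional_probability_integral_transform:
  fixes X :: "'a \<Rightarrow> real" and Q :: "'a \<Rightarrow> real \<Rightarrow> real"
  assumes sub: "subalgebra M F"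
    and X[measurable]: "X \<in> borel_measurable M"
    and Q_F: "\<And>t. (\<lambda>\<omega>. Q \<omega> t) \<in> borel_measurable F"
    and Q_X[measurable]: "(\<lambda>\<omega>. Q \<omega> (X \<omega>)) \<in> borel_measurable M"
    and Q_bounds: "\<And>\<omega> t. \<omega> \<in> space M \<Longrightarrow> 0 \<le> Q \<omega> t \<and> Q \<omega> t \<le> 1"
    and cond: "\<And>t. AE \<omega> in M. real_cond_exp M F (indicator {\<omega> \<in> space M. X \<omega> \<le> t}) \<omega> = Q \<omega> t"
    and regular: "AE \<omega> in M. mono (Q \<omega>) \<and> {0<..<1} \<subseteq> range (Q \<omega>)"
    and A: "A \<in> sets F" and v: "0 < v" "v < 1"
  shows "prob (A \<inter> {\<omega> \<in> space M. Q \<omega> (X \<omega>) < v}) = prob A * v"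
proof -
  interpret finite_measure_subalgebra M F
    by standard (rule sub)
  have Q_M[measurable]: "(\<lambda>\<omega>. Q \<omega> t) \<in> borel_measurable M" for t
    by (rule measurable_from_subalg[OF sub Q_F])
  have F_M: "B \<in> sets M" if "B \<in> sets F" for B
    using sub that by (auto simp: subalgebra_def)
  \<comment> \<open>\<open>E T\<close> approximates \<open>{Q(X) < v}\<close> from inside as \<open>T\<close> exhausts the rationals, and \<open>S T\<close> is its conditional
    probability, which increases to \<open>v\<close>.\<close>
  define E where "E T = {\<omega> \<in> space M. \<exists>t\<in>T. X \<omega> \<le> t \<and> Q \<omega> t < v}" for T
  define S where "S T \<omega> = Max (insert 0 ((\<lambda>t. if Q \<omega> t < v then Q \<omega> t else 0) ` T))" for T \<omega>
  have S_insert: "S (insert b T) \<omega> = max (if Q \<omega> b < v then Q \<omega> b else 0) (S T \<omega>)" if "finite T" for b T \<omega>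
    unfolding S_def image_insert by (subst insert_commute, subst Max_insert) (use that in auto)
  have S_nonneg: "0 \<le> S T \<omega>" if "finite T" for T \<omega>
    using that by (simp add: S_def)
  have S_le: "S T \<omega> \<le> v" if "finite T" for T \<omega>
    unfolding S_def using that v by (subst Max_le_iff) auto
  have S_F[measurable]: "S T \<in> borel_measurable F" if "finite T" for T
    using that
  proof (induction T rule: finite_induct)
    case empty
    then show ?case by (simp add: S_def)
  next
    case (insert b T)
    have "S (insert b T) = (\<lambda>\<omega>. max (if Q \<omega> b < v then Q \<omega> b else 0) (S T \<omega>))"
      using insert.hyps S_insert by auto
    then show ?case
      using insert.IH Q_F by simp
  qed
  have S_M: "S T \<in> borel_measurable M" if "finite T" for T
    by (rule measurable_from_subalg[OF sub S_F[OF that]])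
  have E_M[measurable]: "E T \<in> sets M" if "finite T" for T
    using that unfolding E_def by measurable
  have int_S: "integrable M (\<lambda>\<omega>. indicat_real B \<omega> * S T \<omega>)" if "finite T" "B \<in> sets M" for B T
    using that v S_M[of T] S_nonneg[of T] S_le[of T]
    by (intro integrable_const_bound[where B = v]) (auto simp: indicator_def)
  have int_E: "integrable M (\<lambda>\<omega>. indicat_real B \<omega> * indicat_real C \<omega>)" if "C \<in> sets M" "B \<in> sets M" for B C
    using that by (intro integrable_const_bound[where B = 1]) (auto simp: indicator_def)
  have int_Q: "integrable M (\<lambda>\<omega>. indicat_real B \<omega> * Q \<omega> t)" if "B \<in> sets M" for B t
  proof (rule integrable_const_bound[where B = 1])
    show "AE \<omega> in M. norm (indicat_real B \<omega> * Q \<omega> t) \<le> 1"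
      using Q_bounds by (intro AE_I2) (auto simp: indicator_def)
    show "(\<lambda>\<omega>. indicat_real B \<omega> * Q \<omega> t) \<in> borel_measurable M"
      using that by measurable
  qed
  \<comment> \<open>Thresholds are added in increasing order. On \<open>G\<close>, where the new
    largest \<open>b\<close> is admissible, \<open>E\<close> becomes {X \<le> b} and the maximum
    becomes Q b; off \<open>G\<close> nothing changes. \<open>B\<close> stays arbitrary because the
    induction hypothesis is applied to \<open>B - G\<close>. The default 0 in \<open>S\<close> is
    the conditional probability of the empty event.\<close>
  have fin: "(\<integral>\<omega>. indicat_real B \<omega> * indicat_real (E T) \<omega> \<partial>M) = (\<integral>\<omega>. indicat_real B \<omega> * S T \<omega> \<partial>M)"
    if "finite T" "B \<in> sets F" for B T
    using that
  proof (induction T arbitrary: B rule: finite_linorder_max_induct)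
    case empty
    then show ?case by (simp add: E_def S_def)
  next
    case (insert b T)
    define G where "G = {\<omega> \<in> space M. Q \<omega> b < v}"
    define L where "L = {\<omega> \<in> space M. X \<omega> \<le> b}"
    have spF: "space F = space M"
      using sub by (simp add: subalgebra_def)
    have "G = (\<lambda>\<omega>. Q \<omega> b) -` {..<v} \<inter> space F"
      by (auto simp: G_def spF)
    also have "\<dots> \<in> sets F"
      by (rule measurable_sets[OF Q_F]) simp
    finally have G: "G \<in> sets F" .
    have BG: "B \<inter> G \<in> sets F" "B - G \<in> sets F"
      using insert.prems G by auto
    have L: "L \<in> sets M"
      unfolding L_def by measurable
    have mono_ae: "AE \<omega> in M. mono (Q \<omega>)"
      using regular by eventually_elim simp
    have "(\<integral>\<omega>. indicat_real B \<omega> * indicat_real (E (insert b T)) \<omega> \<partial>M)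
        = (\<integral>\<omega>. indicat_real (B \<inter> G) \<omega> * indicat_real L \<omega> + indicat_real (B - G) \<omega> * indicat_real (E T) \<omega> \<partial>M)"
    proof (rule integral_cong_AE)
      show "AE \<omega> in M. indicat_real B \<omega> * indicat_real (E (insert b T)) \<omega>
         = indicat_real (B \<inter> G) \<omega> * indicat_real L \<omega> + indicat_real (B - G) \<omega> * indicat_real (E T) \<omega>"
        using mono_ae
      proof eventually_elim
        case (elim \<omega>)
        have "X \<omega> \<le> t \<Longrightarrow> t \<in> T \<Longrightarrow> X \<omega> \<le> b" for t
          using insert.hyps(2) by (auto intro: order_trans less_imp_le)
        then show ?case
          by (auto simp: indicator_def E_def G_def L_def)
      qed
    qed (use insert.hyps L BG[THEN F_M] insert.prems[THEN F_M] E_M[of "insert b T"] E_M[of T] in auto)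
    also have "\<dots> = (\<integral>\<omega>. indicat_real (B \<inter> G) \<omega> * indicat_real L \<omega> \<partial>M) + (\<integral>\<omega>. indicat_real (B - G) \<omega> * indicat_real (E T) \<omega> \<partial>M)"
      using insert.hyps L BG[THEN F_M] E_M[of T] by (intro Bochner_Integration.integral_add int_E) auto
    also have "(\<integral>\<omega>. indicat_real (B \<inter> G) \<omega> * indicat_real L \<omega> \<partial>M)
        = (\<integral>\<omega>. indicat_real (B \<inter> G) \<omega> * real_cond_exp M F (indicator L) \<omega> \<partial>M)"
      using BG L by (intro real_cond_exp_intg(2)[symmetric] int_E) (auto dest: F_M)
    also have "\<dots> = (\<integral>\<omega>. indicat_real (B \<inter> G) \<omega> * Q \<omega> b \<partial>M)"
      using cond[of b] BG[THEN F_M] unfolding L_def by (intro integral_cong_AE) auto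
    also have "(\<integral>\<omega>. indicat_real (B - G) \<omega> * indicat_real (E T) \<omega> \<partial>M) = (\<integral>\<omega>. indicat_real (B - G) \<omega> * S T \<omega> \<partial>M)"
      by (rule insert.IH[OF BG(2)])
    also have "(\<integral>\<omega>. indicat_real (B \<inter> G) \<omega> * Q \<omega> b \<partial>M) + (\<integral>\<omega>. indicat_real (B - G) \<omega> * S T \<omega> \<partial>M)
        = (\<integral>\<omega>. indicat_real (B \<inter> G) \<omega> * Q \<omega> b + indicat_real (B - G) \<omega> * S T \<omega> \<partial>M)"
      using insert.hyps BG[THEN F_M]
      by (intro Bochner_Integration.integral_add[symmetric] int_S int_Q)
    also have "\<dots> = (\<integral>\<omega>. indicat_real B \<omega> * S (insert b T) \<omega> \<partial>M)"
    proof (rule integral_cong_AE)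
      show "AE \<omega> in M. indicat_real (B \<inter> G) \<omega> * Q \<omega> b + indicat_real (B - G) \<omega> * S T \<omega>
          = indicat_real B \<omega> * S (insert b T) \<omega>"
        using mono_ae AE_space
      proof eventually_elim
        case (elim \<omega>)
        have "S T \<omega> \<le> Q \<omega> b" if "Q \<omega> b < v"
          using insert.hyps Q_bounds[OF elim(2)] elim(1) that
          by (auto simp: S_def mono_def less_imp_le)
        then show ?case
          using S_nonneg[OF insert.hyps(1), of \<omega>] elim(2) insert.hyps(1)
          by (auto simp: indicator_def G_def S_insert)
      qed
    qed (use insert.hyps BG[THEN F_M] insert.prems[THEN F_M] S_M[of "insert b T"] S_M[of T] in auto)
    finally show ?case .
  qed
  define r where "r = from_nat_into (\<rat> :: real set)"
  have r: "range r = \<rat>"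
    unfolding r_def by (rule range_from_nat_into) (auto simp: countable_rat)
  define T where "T m = r ` {..m}" for m
  have T: "finite (T m)" for m
    by (simp add: T_def)
  let ?V = "{\<omega> \<in> space M. Q \<omega> (X \<omega>) < v}"
  \<comment> \<open>The values one third and two thirds of the way from \<open>a\<close> to
    \<open>v\<close> are attained at some \<open>t < t'\<close>, and a rational between these points
    has its value strictly between \<open>a\<close> and \<open>v\<close>. With
    \<open>a = Q \<omega> (X \<omega>)\<close> this puts \<omega> into some \<open>E (T m)\<close>;
    with \<open>a\<close> close to \<open>v\<close> it makes \<open>S (T m) \<omega>\<close>
    approach \<open>v\<close>.\<close>
  have between: "\<exists>k. Q \<omega> (r k) < v \<and> a < Q \<omega> (r k) \<and> (\<forall>x. Q \<omega> x \<le> a \<longrightarrow> x \<le> r k)"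
    if mono: "mono (Q \<omega>)" and range: "{0<..<1} \<subseteq> range (Q \<omega>)" and a: "0 \<le> a" "a < v" for \<omega> a
  proof -
    have "(2 * a + v) / 3 \<in> {0<..<1}" "(a + 2 * v) / 3 \<in> {0<..<1}"
      using a v by auto
    then have "(2 * a + v) / 3 \<in> range (Q \<omega>)" "(a + 2 * v) / 3 \<in> range (Q \<omega>)"
      using range by blast+
    then obtain t t' where t: "Q \<omega> t = (2 * a + v) / 3" "Q \<omega> t' = (a + 2 * v) / 3"
      by (metis imageE)
    then have "\<not> Q \<omega> t' \<le> Q \<omega> t"
      using a by (auto simp: field_simps)
    then have "t < t'"
      using mono by (meson monoD not_le)
    then obtain q where q: "q \<in> \<rat>" "t < q" "q < t'"
      using Rats_dense_in_real by blast
    then obtain k where k: "q = r k"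
      using r by blast
    have "Q \<omega> t \<le> Q \<omega> q" "Q \<omega> q \<le> Q \<omega> t'"
      using mono q by (auto simp: mono_def)
    moreover have "x \<le> q" if "Q \<omega> x \<le> a" for x
    proof (rule ccontr)
      assume "\<not> x \<le> q"
      then have "Q \<omega> q \<le> Q \<omega> x"
        using mono by (auto simp: mono_def)
      with \<open>Q \<omega> t \<le> Q \<omega> q\<close> that t a show False
        by (simp add: field_simps)
    qed
    ultimately show ?thesis
      using t a by (intro exI[of _ k]) (auto simp: k field_simps)
  qed
  have "(\<lambda>m. \<integral>\<omega>. indicat_real A \<omega> * indicat_real (E (T m)) \<omega> \<partial>M)
      \<longlonglongrightarrow> (\<integral>\<omega>. indicat_real A \<omega> * indicat_real ?V \<omega> \<partial>M)"
  proof (rule integral_dominated_convergence[where w = "\<lambda>_. 1"])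
    show "AE \<omega> in M. (\<lambda>m. indicat_real A \<omega> * indicat_real (E (T m)) \<omega>) \<longlonglongrightarrow> indicat_real A \<omega> * indicat_real ?V \<omega>"
      using regular AE_space
    proof eventually_elim
      case (elim \<omega>)
      show ?case
      proof (cases "\<omega> \<in> ?V")
        case True
        then obtain k where k: "Q \<omega> (r k) < v" "X \<omega> \<le> r k"
          using between[of \<omega> "Q \<omega> (X \<omega>)"] elim Q_bounds by auto
        have "\<forall>\<^sub>F m in sequentially. indicat_real (E (T m)) \<omega> = 1"
          using eventually_ge_at_top[of k]
          by eventually_elim (use k elim in \<open>auto simp: E_def T_def indicator_def\<close>)
        then have "(\<lambda>m. indicat_real (E (T m)) \<omega>) \<longlonglongrightarrow> 1"
          by (rule tendsto_eventually)
        then have "(\<lambda>m. indicat_real A \<omega> * indicat_real (E (T m)) \<omega>) \<longlonglongrightarrow> indicat_real A \<omega> * 1"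
          by (intro tendsto_mult tendsto_const)
        then show ?thesis
          using True by simp
      next
        case False
        have "\<omega> \<notin> E (T m)" for m
        proof
          assume "\<omega> \<in> E (T m)"
          then obtain t where "X \<omega> \<le> t" "Q \<omega> t < v"
            by (auto simp: E_def)
          then have "Q \<omega> (X \<omega>) < v"
            using elim by (auto simp: mono_def intro: le_less_trans)
          then show False
            using False elim by simp
        qed
        then show ?thesis
          using False by simp
      qed
    qed
  qed (use A[THEN F_M] E_M[OF T] in \<open>auto simp: indicator_def\<close>)
  moreover have "(\<lambda>m. \<integral>\<omega>. indicat_real A \<omega> * S (T m) \<omega> \<partial>M) \<longlonglongrightarrow> (\<integral>\<omega>. indicat_real A \<omega> * v \<partial>M)"
  proof (rule integral_dominated_convergence[where w = "\<lambda>_. 1"])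
    show "AE \<omega> in M. (\<lambda>m. indicat_real A \<omega> * S (T m) \<omega>) \<longlonglongrightarrow> indicat_real A \<omega> * v"
      using regular
    proof eventually_elim
      case (elim \<omega>)
      have "(\<lambda>m. S (T m) \<omega>) \<longlonglongrightarrow> v"
      proof (rule LIMSEQ_I)
        fix e :: real assume e: "0 < e"
        \<comment> \<open>The maximum with 0 meets the requirement \<open>0 \<le> a\<close> of
          \<open>between\<close> when \<open>e\<close> exceeds \<open>v\<close>.\<close>
        obtain k where k: "Q \<omega> (r k) < v" "max 0 (v - e) < Q \<omega> (r k)"
          using between[of \<omega> "max 0 (v - e)"] elim e v by auto
        show "\<exists>m0. \<forall>m\<ge>m0. norm (S (T m) \<omega> - v) < e"
        proof (intro exI allI impI)
          fix m assume "k \<le> m"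
          then have "Q \<omega> (r k) \<le> S (T m) \<omega>"
            unfolding S_def using k by (intro Max_ge) (auto simp: T_def intro!: image_eqI[of _ _ "r k"])
          then show "norm (S (T m) \<omega> - v) < e"
            using S_le[OF T, of m \<omega>] k by auto
        qed
      qed
      then show ?case
        by (intro tendsto_mult tendsto_const)
    qed
    show "AE \<omega> in M. norm (indicat_real A \<omega> * S (T m) \<omega>) \<le> 1" for m
      using S_nonneg[OF T, of m] order_trans[OF S_le[OF T, of m] less_imp_le[OF v(2)]]
      by (intro AE_I2) (auto simp: indicator_def)
  qed (use A[THEN F_M] S_M[OF T] in auto)
  ultimately have "(\<integral>\<omega>. indicat_real A \<omega> * indicat_real ?V \<omega> \<partial>M) = (\<integral>\<omega>. indicat_real A \<omega> * v \<partial>M)"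
    unfolding fin[OF T A] by (rule LIMSEQ_unique)
  moreover have "(\<integral>\<omega>. indicat_real A \<omega> * indicat_real ?V \<omega> \<partial>M) = prob (A \<inter> ?V)"
    using A[THEN F_M] by (simp flip: indicator_inter_arith)
  ultimately show ?thesis
    using A[THEN F_M] by simp
qed

lemma AE_uniform_in_unit_interval:
  assumes V[measurable]: "V \<in> borel_measurable M"
    and uniform: "\<And>v. 0 < v \<Longrightarrow> v < 1 \<Longrightarrow> prob {\<omega> \<in> space M. V \<omega> < v} = v"
  shows "AE \<omega> in M. 0 < V \<omega> \<and> V \<omega> < 1"
proof -
  have "prob {\<omega> \<in> space M. V \<omega> \<le> 0} \<le> 0 + e" if "0 < e" for e
  proof -
    \<comment> \<open>The cap 1 / 2 keeps the argument of \<open>uniform\<close> inside (0,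
      1).\<close>
    have "prob {\<omega> \<in> space M. V \<omega> \<le> 0} \<le> prob {\<omega> \<in> space M. V \<omega> < min e (1 / 2)}"
      using that by (intro finite_measure_mono) auto
    also have "\<dots> = min e (1 / 2)"
      using that by (subst uniform) (auto simp: min_def)
    finally show ?thesis
      by simp
  qed
  then have 0: "prob {\<omega> \<in> space M. V \<omega> \<le> 0} = 0"
    by (intro antisym[OF field_le_epsilon]) auto
  have "1 \<le> prob {\<omega> \<in> space M. V \<omega> < 1} + e" if "0 < e" for e
  proof -
    have "1 - min e (1 / 2) = prob {\<omega> \<in> space M. V \<omega> < 1 - min e (1 / 2)}"
      using that by (subst uniform) (auto simp: min_def)
    also have "\<dots> \<le> prob {\<omega> \<in> space M. V \<omega> < 1}"
      using that by (intro finite_measure_mono) auto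
    finally show ?thesis
      by simp
  qed
  then have 1: "prob {\<omega> \<in> space M. V \<omega> < 1} = 1"
    by (intro antisym[OF _ field_le_epsilon]) auto
  have "AE \<omega> in M. V \<omega> < 1"
    using 1 by (simp add: prob_Collect_eq_1)
  moreover have "AE \<omega> in M. \<not> V \<omega> \<le> 0"
    using 0 by (simp add: prob_Collect_eq_0)
  ultimately show ?thesis
    by eventually_elim simp
qed

text \<open>Freezing argument: the normal score \<open>Z\<close> of \<open>V\<close> is independent
  of \<open>F\<close>, so the joint law of \<omega>, seen through \<open>F\<close>, and
  \<open>Z\<close> is a product. By Fubini \<open>U \<omega>\<close> is held fixed while
  \<open>Z\<close> is integrated out, and \<open>integral_copula_H\<close> returns
  \<open>U \<omega>\<close>.\<close>

lemma real_cond_exp_copula_H: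
  assumes sub: "subalgebra M F"
    and V[measurable]: "V \<in> borel_measurable M"
    and uniform: "\<And>A v. A \<in> sets F \<Longrightarrow> 0 < v \<Longrightarrow> v < 1 \<Longrightarrow> prob (A \<inter> {\<omega> \<in> space M. V \<omega> < v}) = prob A * v"
    and U_F: "U \<in> borel_measurable F"
    and U_bounds: "\<And>\<omega>. \<omega> \<in> space M \<Longrightarrow> 0 \<le> U \<omega> \<and> U \<omega> \<le> 1"
    and \<rho>: "0 < \<rho>" "\<rho> < 1"
  shows "AE \<omega> in M. real_cond_exp M F (\<lambda>\<omega>. copula_H \<rho> (U \<omega>) (V \<omega>)) \<omega> = U \<omega>"
proof -
  interpret finite_measure_subalgebra M F
    by standard (rule sub)
  let ?N = std_normal_distribution
  have spF: "space F = space M"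
    using sub by (simp add: subalgebra_def)
  have F_M: "B \<in> sets M" if "B \<in> sets F" for B
    using sub that by (auto simp: subalgebra_def)
  have U_M[measurable]: "U \<in> borel_measurable M"
    by (rule measurable_from_subalg[OF sub U_F])
  \<comment> \<open>\<open>real_of_ereal\<close> gives \<open>Z\<close> the value 0 where the
    quantile is infinite, that is where \<open>V\<close> leaves (0, 1), a null event.\<close>
  define Z where "Z \<omega> = real_of_ereal (std_normal_quantile (V \<omega>))" for \<omega>
  have Z[measurable]: "Z \<in> borel_measurable M"
    unfolding Z_def by measurable
  have "space M \<in> sets F"
    using spF sets.top[of F] by simp
  then have V_01: "AE \<omega> in M. 0 < V \<omega> \<and> V \<omega> < 1"
    using uniform[of "space M"] by (intro AE_uniform_in_unit_interval V) (auto simp: prob_space Int_absorb1)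
  have V_Z: "AE \<omega> in M. V \<omega> = Phi (Z \<omega>)"
    using V_01
  proof eventually_elim
    case (elim \<omega>)
    then obtain x where "Phi x = V \<omega>"
      using Phi_surj by blast
    then show ?case
      by (simp add: Z_def flip: \<open>Phi x = V \<omega>\<close>)
  qed
  \<comment> \<open>Letting \<open>v'\<close> decrease to \<open>v\<close> trades the strict
    inequality for the weak one that a CDF requires.\<close>
  have uniform_le: "prob (A \<inter> {\<omega> \<in> space M. V \<omega> \<le> v}) = prob A * v" if A: "A \<in> sets F" and v: "0 < v" "v < 1" for A v
  proof (rule antisym)
    note [measurable] = F_M[OF A]
    have "prob A * v = prob (A \<inter> {\<omega> \<in> space M. V \<omega> < v})"
      by (rule uniform[OF A v, symmetric])
    also have "\<dots> \<le> prob (A \<inter> {\<omega> \<in> space M. V \<omega> \<le> v})"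
      by (intro finite_measure_mono) auto
    finally show "prob A * v \<le> prob (A \<inter> {\<omega> \<in> space M. V \<omega> \<le> v})" .
    have "prob (A \<inter> {\<omega> \<in> space M. V \<omega> \<le> v}) \<le> prob A * v'" if "v < v'" "v' < 1" for v'
    proof -
      have "prob (A \<inter> {\<omega> \<in> space M. V \<omega> \<le> v}) \<le> prob (A \<inter> {\<omega> \<in> space M. V \<omega> < v'})"
        using that by (intro finite_measure_mono) auto
      also have "\<dots> = prob A * v'"
        using that v by (intro uniform[OF A]) auto
      finally show ?thesis .
    qed
    then have "\<forall>\<^sub>F v' in at_right v. prob (A \<inter> {\<omega> \<in> space M. V \<omega> \<le> v}) \<le> prob A * v'"
      unfolding eventually_at_right[OF v(2)] using v(2) by (intro exI[of _ 1]) auto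
    moreover have "((\<lambda>v'. prob A * v') \<longlongrightarrow> prob A * v) (at_right v)"
      by (intro tendsto_intros)
    ultimately show "prob (A \<inter> {\<omega> \<in> space M. V \<omega> \<le> v}) \<le> prob A * v"
      by (intro tendsto_lowerbound) auto
  qed
  have normal: "prob (A \<inter> {\<omega> \<in> space M. Z \<omega> \<le> z}) = prob A * Phi z" if A: "A \<in> sets F" for A z
  proof -
    note [measurable] = F_M[OF A]
    have "prob (A \<inter> {\<omega> \<in> space M. Z \<omega> \<le> z}) = prob (A \<inter> {\<omega> \<in> space M. V \<omega> \<le> Phi z})"
    proof (rule finite_measure_eq_AE)
      show "AE \<omega> in M. \<omega> \<in> A \<inter> {\<omega> \<in> space M. Z \<omega> \<le> z} \<longleftrightarrow> \<omega> \<in> A \<inter> {\<omega> \<in> space M. V \<omega> \<le> Phi z}"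
        using V_Z by eventually_elim (simp add: Phi_le_iff)
    qed auto
    then show ?thesis
      using uniform_le[OF A Phi_pos Phi_less_1] by simp
  qed
  have law_Z: "distr M borel Z = ?N"
  proof (rule cdf_unique)
    show "cdf (distr M borel Z) = Phi"
    proof
      fix z
      have "Z -` {..z} \<inter> space M = space M \<inter> {\<omega> \<in> space M. Z \<omega> \<le> z}"
        by auto
      then show "cdf (distr M borel Z) z = Phi z"
        using normal[OF \<open>space M \<in> sets F\<close>, of z] by (simp add: cdf_def measure_distr prob_space)
    qed
  qed (auto intro: real_dist_normal_dist)
  \<comment> \<open>The identity into the coarser \<open>F\<close> is a random element that carries
    exactly the information of \<open>F\<close>; its joint law with \<open>Z\<close> can then be
    formed.\<close>
  have id_F: "(\<lambda>\<omega>. \<omega>) \<in> measurable M F"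
    by (rule measurableI) (use F_M spF in auto)
  \<comment> \<open>The product rule is known for half-lines {Z \<le> z}; being an
    intersection-stable generator, they extend it to all Borel sets.\<close>
  have indep: "indep_set (sets F) {Z -` B \<inter> space M |B. B \<in> sets borel}"
  proof -
    let ?G = "{Z -` B \<inter> space M |B. B \<in> range atMost}"
    have "indep_set (sigma_sets (space M) (sets F)) (sigma_sets (space M) ?G)"
    proof (rule indep_set_sigma_sets)
      show "indep_set (sets F) ?G"
      proof (rule indep_setI)
        show "sets F \<subseteq> events"
          using F_M by auto
        show "?G \<subseteq> events"
          by auto
        fix A b assume A: "A \<in> sets F" and "b \<in> ?G"
        then obtain z where b: "b = {\<omega> \<in> space M. Z \<omega> \<le> z}"
          by auto
        then have "space M \<inter> b = b"
          by auto
        then show "prob (A \<inter> b) = prob A * prob b"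
          using normal[OF A, of z] normal[OF \<open>space M \<in> sets F\<close>, of z] by (simp add: b prob_space)
      qed
      show "Int_stable (sets F)"
        by (auto simp: Int_stable_def)
      show "Int_stable ?G"
      proof (rule Int_stableI)
        fix a b assume "a \<in> ?G" "b \<in> ?G"
        then obtain x y where "a = Z -` {..x} \<inter> space M" "b = Z -` {..y} \<inter> space M"
          by auto
        then have "a \<inter> b = Z -` {..min x y} \<inter> space M"
          by auto
        then show "a \<inter> b \<in> ?G"
          by blast
      qed
    qed
    moreover have "sigma_sets (space M) (sets F) = sets F"
      using sets.sigma_sets_eq[of F] spF by simp
    moreover have "sigma_sets (space M) ?G = {Z -` B \<inter> space M |B. B \<in> sets borel}"
      using sigma_sets_vimage_commute[of Z "space M" UNIV "range atMost"] by (simp add: borel_eq_atMost)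
    ultimately show ?thesis
      by simp
  qed
  have joint: "distr M F (\<lambda>\<omega>. \<omega>) \<Otimes>\<^sub>M ?N = distr M (F \<Otimes>\<^sub>M borel) (\<lambda>\<omega>. (\<omega>, Z \<omega>))"
  proof (rule pair_measure_eqI)
    show "sigma_finite_measure (distr M F (\<lambda>\<omega>. \<omega>))"
      by (intro prob_space_imp_sigma_finite prob_space_distr id_F)
    show "sigma_finite_measure ?N"
      by (intro prob_space_imp_sigma_finite std_normal.prob_space_axioms)
    show "sets (distr M F (\<lambda>\<omega>. \<omega>) \<Otimes>\<^sub>M ?N) = sets (distr M (F \<Otimes>\<^sub>M borel) (\<lambda>\<omega>. (\<omega>, Z \<omega>)))"
      by (simp cong: sets_pair_measure_cong)
    fix A B assume "A \<in> sets (distr M F (\<lambda>\<omega>. \<omega>))" "B \<in> sets ?N"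
    then have A: "A \<in> sets F" and B: "B \<in> sets borel"
      by auto
    have A_sp: "A \<inter> space M = A"
      using sets.sets_into_space[OF A] spF by auto
    have pair: "(\<lambda>\<omega>. (\<omega>, Z \<omega>)) \<in> measurable M (F \<Otimes>\<^sub>M borel)"
      using id_F by measurable
    have eq: "(\<lambda>\<omega>. (\<omega>, Z \<omega>)) -` (A \<times> B) \<inter> space M = A \<inter> (Z -` B \<inter> space M)"
      by auto
    have "emeasure ?N B = emeasure (distr M borel Z) B"
      by (simp add: law_Z)
    also have "\<dots> = emeasure M (Z -` B \<inter> space M)"
      by (rule emeasure_distr[OF Z B])
    finally have "emeasure (distr M F (\<lambda>\<omega>. \<omega>)) A * emeasure ?N B = emeasure M A * emeasure M (Z -` B \<inter> space M)"
      using emeasure_distr[OF id_F A] A_sp by simp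
    also have "\<dots> = emeasure M (A \<inter> (Z -` B \<inter> space M))"
    proof -
      have "Z -` B \<inter> space M \<in> {Z -` B \<inter> space M |B. B \<in> sets borel}"
        using B by blast
      from indep_setD[OF indep A this] show ?thesis
        by (simp add: emeasure_eq_measure ennreal_mult)
    qed
    finally show "emeasure (distr M F (\<lambda>\<omega>. \<omega>)) A * emeasure ?N B
        = emeasure (distr M (F \<Otimes>\<^sub>M borel) (\<lambda>\<omega>. (\<omega>, Z \<omega>))) (A \<times> B)"
      using A B by (subst emeasure_distr[OF pair]) (auto simp: eq)
  qed
  show ?thesis
  proof (rule real_cond_exp_charact)
    fix A assume A: "A \<in> sets F"
    note [measurable] = F_M[OF A]
    define f where "f x = indicat_real A (fst x) * copula_H \<rho> (U (fst x)) (Phi (snd x))" for x :: "'a \<times> real"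
    have Phi_borel: "Phi \<in> borel_measurable borel"
      by (intro borel_measurable_mono strict_mono_mono strict_mono_Phi)
    have f[measurable]: "f \<in> borel_measurable (F \<Otimes>\<^sub>M borel)"
      unfolding f_def
      by (intro borel_measurable_times borel_measurable_copula_H
          measurable_compose[OF measurable_fst U_F] measurable_compose[OF measurable_snd Phi_borel]
          measurable_compose[OF measurable_fst borel_measurable_indicator[OF A]])
    interpret D: prob_space "distr M F (\<lambda>\<omega>. \<omega>)"
      by (rule prob_space_distr[OF id_F])
    interpret pair: pair_prob_space "distr M F (\<lambda>\<omega>. \<omega>)" "?N" ..
    have "(\<integral>\<omega>\<in>A. copula_H \<rho> (U \<omega>) (V \<omega>) \<partial>M) = (\<integral>\<omega>. f (\<omega>, Z \<omega>) \<partial>M)"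
      unfolding set_lebesgue_integral_def
    proof (rule integral_cong_AE)
      show "AE \<omega> in M. indicat_real A \<omega> *\<^sub>R copula_H \<rho> (U \<omega>) (V \<omega>) = f (\<omega>, Z \<omega>)"
        using V_Z by eventually_elim (simp add: f_def)
      show "(\<lambda>\<omega>. f (\<omega>, Z \<omega>)) \<in> borel_measurable M"
        using id_F by measurable
    qed measurable
    also have "\<dots> = (\<integral>x. f x \<partial>distr M (F \<Otimes>\<^sub>M borel) (\<lambda>\<omega>. (\<omega>, Z \<omega>)))"
      using id_F by (intro integral_distr[symmetric]) auto
    also have "distr M (F \<Otimes>\<^sub>M borel) (\<lambda>\<omega>. (\<omega>, Z \<omega>)) = distr M F (\<lambda>\<omega>. \<omega>) \<Otimes>\<^sub>M ?N"
      by (rule joint[symmetric])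
    also have "(\<integral>x. f x \<partial>\<dots>) = (\<integral>\<omega>. (\<integral>z. f (\<omega>, z) \<partial>?N) \<partial>distr M F (\<lambda>\<omega>. \<omega>))"
    proof (rule pair.integral_fst'[symmetric])
      have "f \<in> borel_measurable (distr M F (\<lambda>\<omega>. \<omega>) \<Otimes>\<^sub>M ?N)"
        using f by (simp cong: measurable_cong_sets sets_pair_measure_cong)
      then show "integrable (distr M F (\<lambda>\<omega>. \<omega>) \<Otimes>\<^sub>M ?N) f"
        using copula_H_nonneg copula_H_le_1
        by (intro pair.integrable_const_bound[where B = 1]) (auto simp: f_def indicator_def)
    qed
    also have "\<dots> = (\<integral>\<omega>. indicat_real A \<omega> * U \<omega> \<partial>distr M F (\<lambda>\<omega>. \<omega>))"
      using U_bounds spF \<rho>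
      by (intro Bochner_Integration.integral_cong) (auto simp: f_def integral_copula_H)
    also have "\<dots> = (\<integral>\<omega>. indicat_real A \<omega> * U \<omega> \<partial>M)"
      using id_F A U_F by (intro integral_distr) auto
    finally show "(\<integral>\<omega>\<in>A. copula_H \<rho> (U \<omega>) (V \<omega>) \<partial>M) = (\<integral>\<omega>\<in>A. U \<omega> \<partial>M)"
      by (simp add: set_lebesgue_integral_def)
  next
    show "integrable M (\<lambda>\<omega>. copula_H \<rho> (U \<omega>) (V \<omega>))"
      using copula_H_nonneg copula_H_le_1 by (intro integrable_const_bound[where B = 1]) auto
    show "integrable M U"
      using U_bounds by (intro integrable_const_bound[where B = 1]) auto
  qed (rule U_F)
qed

end

text \<open>\<open>Q' t\<close> depends on \<open>t\<close> only through \<open>Q t\<close>: where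
  \<open>Q t = Phi x\<close> it equals \<open>f x\<close>, for a continuous \<open>f\<close> with
  limits 0 and 1 at the two ends. Since \<open>Q\<close> attains every \<open>Phi x\<close>,
  \<open>Q'\<close> attains every value of \<open>f\<close>, hence all of (0, 1).\<close>

lemma regular_cdf_update:
  fixes Q :: "real \<Rightarrow> real" and z :: real
  assumes Q: "mono Q" "{0<..<1} \<subseteq> range Q" "\<And>t. 0 \<le> Q t \<and> Q t \<le> 1"
    and \<alpha>: "0 \<le> \<alpha>" "\<alpha> \<le> 1" and \<rho>: "\<bar>\<rho>\<bar> < 1"
  defines "Q' \<equiv> \<lambda>t. (1 - \<alpha>) * Q t + \<alpha> * copula_H \<rho> (Q t) (Phi z)"
  shows "mono Q'" "{0<..<1} \<subseteq> range Q'"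
proof -
  show "mono Q'"
  proof (rule monoI)
    fix s t :: real assume "s \<le> t"
    then have "Q s \<le> Q t"
      using Q(1) by (simp add: mono_def)
    then show "Q' s \<le> Q' t"
      unfolding Q'_def using Q(3) \<alpha> \<rho> by (intro add_mono mult_left_mono copula_H_mono) auto
  qed
  define s where "s = sqrt (1 - \<rho>\<^sup>2)"
  have s: "0 < s"
    using \<rho> by (simp add: s_def abs_square_less_1)
  define f where "f x = (1 - \<alpha>) * Phi x + \<alpha> * Phi ((x - \<rho> * z) / s)" for x
  have "{0<..<1} \<subseteq> range f"
  proof (rule surj_onto_unit_interval)
    show "isCont f x" for x
      unfolding f_def using s by (intro continuous_intros isCont_o2[OF _ isCont_Phi]) auto
    have bot: "filterlim (\<lambda>x. (x - \<rho> * z) / s) at_bot at_bot"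
      using s by real_asymp
    have top: "filterlim (\<lambda>x. (x - \<rho> * z) / s) at_top at_top"
      using s by real_asymp
    have "(f \<longlongrightarrow> (1 - \<alpha>) * 0 + \<alpha> * 0) at_bot"
      unfolding f_def
      by (intro tendsto_intros std_normal.cdf_lim_at_bot filterlim_compose[OF std_normal.cdf_lim_at_bot bot])
    then show "(f \<longlongrightarrow> 0) at_bot" by simp
    have "(f \<longlongrightarrow> (1 - \<alpha>) * 1 + \<alpha> * 1) at_top"
      unfolding f_def
      by (intro tendsto_intros std_normal.cdf_lim_at_top_prob filterlim_compose[OF std_normal.cdf_lim_at_top_prob top])
    then show "(f \<longlongrightarrow> 1) at_top" by simp
  qed
  moreover have "f x \<in> range Q'" for x
  proof -
    obtain t where "Q t = Phi x"
      using Q(2) Phi_pos[of x] Phi_less_1[of x] by (metis greaterThanLessThan_iff imageE subsetD)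
    then have "Q' t = f x"
      by (simp add: Q'_def f_def copula_H_Phi[OF \<rho>] s_def)
    then show ?thesis
      by (metis rangeI)
  qed
  ultimately show "{0<..<1} \<subseteq> range Q'"
    by auto
qed

section \<open>The forward sampling scheme\<close>

text \<open>\<open>1 \<le> i\<close> means i + 1 \<ge> 2, which offsets the factor 2^\<beta>. The
  bound by 1 makes each update a convex combination; for i = n + k it comes from n \<ge> 1.\<close>

lemma learning_rate_bounds:
  assumes "1 \<le> i" "0 \<le> \<beta>"
  shows "0 < learning_rate \<beta> i" "learning_rate \<beta> i \<le> 1"
proof -
  show "0 < learning_rate \<beta> i"
    by (simp add: learning_rate_def)
  have "2 powr \<beta> \<le> real (i + 1) powr \<beta>"
    using assms by (intro powr_mono2) auto
  then show "learning_rate \<beta> i \<le> 1"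
    by (simp add: learning_rate_def powr_minus divide_simps)
qed

text \<open>Integral comparison in discrete form: by the mean value theorem (i + 1)^(-2 \<beta>),
  times 2 \<beta> - 1, is at most the drop of x^(1 - 2 \<beta>) over [i, i + 1]. The shift to i + 1
  in the learning rate lets the telescoping sum start exactly at \<open>n\<close>.\<close>

lemma sum_learning_rate_squared_le:
  assumes n: "1 \<le> n" and \<beta>: "1 / 2 < \<beta>"
  shows "(\<Sum>k<N. (learning_rate \<beta> (n + k))\<^sup>2) \<le> 2 powr (2 * \<beta>) * real n powr (1 - 2 * \<beta>) / (2 * \<beta> - 1)"
proof -
  let ?f = "\<lambda>x :: real. x powr (1 - 2 * \<beta>)"
  have step: "(2 * \<beta> - 1) * (x + 1) powr (- 2 * \<beta>) \<le> ?f x - ?f (x + 1)" if x: "0 < x" for x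
  proof -
    have "\<exists>z>x. z < x + 1 \<and> ?f (x + 1) - ?f x = (x + 1 - x) * ((1 - 2 * \<beta>) * z powr (1 - 2 * \<beta> - 1))"
      using x by (intro MVT2 has_real_derivative_powr) auto
    then obtain z where z: "x < z" "z < x + 1" "?f (x + 1) - ?f x = (1 - 2 * \<beta>) * z powr (- 2 * \<beta>)"
      by auto
    have "(x + 1) powr (- 2 * \<beta>) \<le> z powr (- 2 * \<beta>)"
      using x z \<beta> by (intro powr_mono2') auto
    then have "(2 * \<beta> - 1) * (x + 1) powr (- 2 * \<beta>) \<le> (2 * \<beta> - 1) * z powr (- 2 * \<beta>)"
      using \<beta> by (intro mult_left_mono) auto
    then show ?thesis
      using z(3) by (simp add: algebra_simps)
  qed
  have sq: "(learning_rate \<beta> i)\<^sup>2 = 2 powr (2 * \<beta>) * (real i + 1) powr (- 2 * \<beta>)" for i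
    by (simp add: learning_rate_def power_mult_distrib powr_power mult.commute add.commute)
  have "(2 * \<beta> - 1) * (\<Sum>k<N. (learning_rate \<beta> (n + k))\<^sup>2) \<le> 2 powr (2 * \<beta>) * (?f (real n) - ?f (real (n + N)))"
  proof (induction N)
    case (Suc N)
    have "2 powr (2 * \<beta>) * ((2 * \<beta> - 1) * (real (n + N) + 1) powr (- 2 * \<beta>))
        \<le> 2 powr (2 * \<beta>) * (?f (real (n + N)) - ?f (real (n + N) + 1))"
      using n by (intro mult_left_mono step) auto
    then show ?case
      using Suc by (simp add: sq algebra_simps)
  qed simp
  also have "\<dots> \<le> 2 powr (2 * \<beta>) * ?f (real n)"
    by (intro mult_left_mono) auto
  finally show ?thesis
    using \<beta> by (simp add: field_simps)
qed

section \<open>The filtration of the samples and regularity of the random CDFs\<close>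

lemma measurable_generated_by:
  "i \<in> I \<Longrightarrow> Y i \<in> borel_measurable (generated_by M Y I)"
proof -
  assume i: "i \<in> I"
  have "(\<lambda>\<omega>. \<lambda>i\<in>I. Y i \<omega>) \<in> measurable (generated_by M Y I) (Pi\<^sub>M I (\<lambda>_. borel))"
    unfolding generated_by_def by (rule measurable_vimage_algebra1) (auto simp: space_PiM)
  from measurable_compose[OF this measurable_component_singleton[OF i]] show ?thesis
    using i by simp
qed

lemma subalgebra_generated_by:
  assumes "space N = space M" "\<And>i. i \<in> I \<Longrightarrow> Y i \<in> borel_measurable N"
  shows "subalgebra N (generated_by M Y I)"
proof -
  have Y: "(\<lambda>\<omega>. \<lambda>i\<in>I. Y i \<omega>) \<in> measurable N (Pi\<^sub>M I (\<lambda>_. borel))"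
    using assms by (intro measurable_restrict) auto
  have "sets (generated_by M Y I) = {(\<lambda>\<omega>. \<lambda>i\<in>I. Y i \<omega>) -` A \<inter> space M | A. A \<in> sets (Pi\<^sub>M I (\<lambda>_. borel))}"
    unfolding generated_by_def by (rule sets_vimage_algebra2) (auto simp: space_PiM)
  also have "\<dots> \<subseteq> sets N"
    using measurable_sets[OF Y] assms(1) by auto
  finally show ?thesis
    using assms(1) by (simp add: subalgebra_def generated_by_def)
qed

text \<open>Absolute continuity of the initial law enters as \<open>P0_range\<close>. The
  assumptions on \<open>P0\<close> have the form that the recursion preserves: the bounds surely,
  the other two almost surely.\<close>

locale regular_copula_sampling = gaussian_copula_forward_sampling +
  assumes n: "1 \<le> n" and \<rho>: "0 < \<rho>" "\<rho> < 1" and \<beta>: "1 / 2 < \<beta>"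
    and P0_mono: "mono P0" and P0_range: "{0<..<1} \<subseteq> range P0" and P0_bounds: "\<And>t. 0 \<le> P0 t \<and> P0 t \<le> 1"
begin

text \<open>The index set is the one in \<open>sample\<close> at \<open>Suc k\<close>: the first
  \<open>k\<close> forward samples, given which \<open>P k\<close> is the conditional CDF of
  \<open>Y (n + Suc k)\<close>. At \<open>k = 0\<close> it is empty and the sigma-algebra
  trivial.\<close>

definition history :: "nat \<Rightarrow> 'a measure" where
  "history k = generated_by M Y {n + 1..<n + Suc k}"

text \<open>Shifted by one against \<open>update\<close>: the step from \<open>P k\<close> to
  \<open>P (Suc k)\<close> uses the learning rate of index n + k.\<close>

definition rate :: "nat \<Rightarrow> real" where
  "rate k = learning_rate \<beta> (n + k)"

definition increment :: "real \<Rightarrow> nat \<Rightarrow> 'a \<Rightarrow> real" where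
  "increment y k \<omega> = P (Suc k) \<omega> y - P k \<omega> y"

lemma space_history: "space (history k) = space M"
  by (simp add: history_def generated_by_def)

lemma Y_history: "k < j \<Longrightarrow> Y (n + Suc k) \<in> borel_measurable (history j)"
  unfolding history_def by (rule measurable_generated_by) auto

lemma subalgebra_history: "subalgebra M (history k)"
  unfolding history_def
proof (rule subalgebra_generated_by[OF refl])
  fix i assume "i \<in> {n + 1..<n + Suc k}"
  then show "Y i \<in> borel_measurable M"
    using random_variable_Y[of "i - n"] by auto
qed

lemma subalgebra_history_Suc: "subalgebra (history (Suc k)) (history k)"
  unfolding history_def[of k]
proof (rule subalgebra_generated_by[OF space_history])
  fix i assume "i \<in> {n + 1..<n + Suc k}"
  then show "Y i \<in> borel_measurable (history (Suc k))"
    unfolding history_def by (intro measurable_generated_by) auto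
qed

lemma rate_bounds: "0 < rate k" "rate k \<le> 1"
  unfolding rate_def using n \<beta> by (auto intro!: learning_rate_bounds)

lemma P_Suc:
  "\<omega> \<in> space M \<Longrightarrow> P (Suc k) \<omega> y
     = (1 - rate k) * P k \<omega> y + rate k * copula_H \<rho> (P k \<omega> y) (P k \<omega> (Y (n + Suc k) \<omega>))"
  using update[of "Suc k" \<omega> y] by (simp add: rate_def)

lemma P_bounds: "\<omega> \<in> space M \<Longrightarrow> 0 \<le> P k \<omega> t \<and> P k \<omega> t \<le> 1"
proof (induction k)
  case 0
  then show ?case by (simp add: initial P0_bounds)
next
  case (Suc k)
  then have IH: "0 \<le> P k \<omega> t" "P k \<omega> t \<le> 1" by auto
  let ?H = "copula_H \<rho> (P k \<omega> t) (P k \<omega> (Y (n + Suc k) \<omega>))"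
  have "(1 - rate k) * P k \<omega> t + rate k * ?H \<le> (1 - rate k) * 1 + rate k * 1"
    using IH rate_bounds[of k] by (intro add_mono mult_left_mono) (auto simp: copula_H_le_1)
  moreover have "0 \<le> (1 - rate k) * P k \<omega> t + rate k * ?H"
    using IH rate_bounds[of k] by (intro add_nonneg_nonneg mult_nonneg_nonneg) (auto simp: copula_H_nonneg)
  ultimately show ?case
    using Suc.prems by (simp add: P_Suc)
qed

text \<open>Joint measurability is what allows \<open>P k\<close> to be evaluated at the random
  point \<open>Y (n + Suc k) \<omega>\<close>, as the next update does.\<close>

lemma P_measurable: "(\<lambda>(\<omega>, t). P k \<omega> t) \<in> borel_measurable (history k \<Otimes>\<^sub>M borel)"
proof (induction k)
  case 0
  have "(\<lambda>x. P0 (snd x)) \<in> borel_measurable (history 0 \<Otimes>\<^sub>M borel)"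
    by (intro measurable_compose[OF measurable_snd] borel_measurable_mono P0_mono)
  moreover have "(\<lambda>(\<omega>, t). P 0 \<omega> t) \<in> borel_measurable (history 0 \<Otimes>\<^sub>M borel)
      \<longleftrightarrow> (\<lambda>x. P0 (snd x)) \<in> borel_measurable (history 0 \<Otimes>\<^sub>M borel)"
    by (rule measurable_cong) (auto simp: space_pair_measure space_history initial)
  ultimately show ?case
    by simp
next
  case (Suc k)
  have fst: "fst \<in> measurable (history (Suc k) \<Otimes>\<^sub>M borel) (history k)"
    by (rule measurable_compose[OF measurable_fst])
       (use subalgebra_history_Suc[of k] in \<open>auto simp: subalgebra_def measurable_def\<close>)
  have comp: "(\<lambda>x. P k (fst x) (g x)) \<in> borel_measurable (history (Suc k) \<Otimes>\<^sub>M borel)"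
    if "g \<in> borel_measurable (history (Suc k) \<Otimes>\<^sub>M borel)" for g
    using measurable_compose[OF measurable_Pair[OF fst that] Suc] by simp
  have Y: "(\<lambda>x. Y (n + Suc k) (fst x)) \<in> borel_measurable (history (Suc k) \<Otimes>\<^sub>M borel)"
    by (rule measurable_compose[OF measurable_fst Y_history]) simp
  let ?g = "\<lambda>x. (1 - rate k) * P k (fst x) (snd x)
      + rate k * copula_H \<rho> (P k (fst x) (snd x)) (P k (fst x) (Y (n + Suc k) (fst x)))"
  have "?g \<in> borel_measurable (history (Suc k) \<Otimes>\<^sub>M borel)"
    by (intro borel_measurable_add borel_measurable_times borel_measurable_const borel_measurable_copula_H
        comp measurable_snd Y)
  moreover have "(\<lambda>(\<omega>, t). P (Suc k) \<omega> t) \<in> borel_measurable (history (Suc k) \<Otimes>\<^sub>M borel)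
      \<longleftrightarrow> ?g \<in> borel_measurable (history (Suc k) \<Otimes>\<^sub>M borel)"
    by (rule measurable_cong) (auto simp: space_pair_measure space_history P_Suc)
  ultimately show ?case
    by simp
qed

lemma P_history: "(\<lambda>\<omega>. P k \<omega> t) \<in> borel_measurable (history k)"
proof -
  have "(\<lambda>\<omega>. (\<omega>, t)) \<in> measurable (history k) (history k \<Otimes>\<^sub>M borel)"
    by measurable
  from measurable_compose[OF this P_measurable] show ?thesis
    by simp
qed

lemma P_M: "(\<lambda>\<omega>. P k \<omega> t) \<in> borel_measurable M"
  by (rule measurable_from_subalg[OF subalgebra_history P_history])

lemma P_Y_M: "(\<lambda>\<omega>. P k \<omega> (Y (n + Suc k) \<omega>)) \<in> borel_measurable M"
proof -
  have "(\<lambda>\<omega>. (\<omega>, Y (n + Suc k) \<omega>)) \<in> measurable M (history k \<Otimes>\<^sub>M borel)"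
    using subalgebra_history[of k] random_variable_Y[of "Suc k"]
    by (intro measurable_Pair) (auto simp: subalgebra_def measurable_def)
  from measurable_compose[OF this P_measurable] show ?thesis
    by simp
qed

text \<open>The two facts feed each other: regularity at \<open>k\<close> makes
  \<open>P k \<omega> (Y (n + Suc k) \<omega>)\<close> uniform, hence almost surely in (0, 1), hence
  of the form \<open>Phi z\<close>; with such a \<open>z\<close> the update preserves regularity at
  \<open>Suc k\<close>.\<close>

lemma
  shows regular: "AE \<omega> in M. mono (P k \<omega>) \<and> {0<..<1} \<subseteq> range (P k \<omega>)"
    and uniform: "A \<in> sets (history k) \<Longrightarrow> 0 < v \<Longrightarrow> v < 1 \<Longrightarrow>
      prob (A \<inter> {\<omega> \<in> space M. P k \<omega> (Y (n + Suc k) \<omega>) < v}) = prob A * v"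
proof -
  have uniform_if: "prob (A \<inter> {\<omega> \<in> space M. P k \<omega> (Y (n + Suc k) \<omega>) < v}) = prob A * v"
    if "AE \<omega> in M. mono (P k \<omega>) \<and> {0<..<1} \<subseteq> range (P k \<omega>)" "A \<in> sets (history k)" "0 < v" "v < 1" for A v k
    using sample[of "Suc k"] random_variable_Y[of "Suc k"] that
    by (intro conditional_probability_integral_transform[of "history k"] subalgebra_history P_history P_Y_M P_bounds)
       (auto simp: history_def)
  show reg: "AE \<omega> in M. mono (P k \<omega>) \<and> {0<..<1} \<subseteq> range (P k \<omega>)" for k
  proof (induction k)
    case 0
    then show ?case
      by (intro AE_I2) (simp add: initial P0_mono P0_range)
  next
    case (Suc k)
    have "prob {\<omega> \<in> space M. P k \<omega> (Y (n + Suc k) \<omega>) < v} = v" if "0 < v" "v < 1" for v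
      using uniform_if[OF Suc, of "space M" v] that sets.top[of "history k"]
      by (simp add: space_history prob_space Int_def)
    then have "AE \<omega> in M. 0 < P k \<omega> (Y (n + Suc k) \<omega>) \<and> P k \<omega> (Y (n + Suc k) \<omega>) < 1"
      by (intro AE_uniform_in_unit_interval P_Y_M)
    with Suc AE_space show ?case
    proof eventually_elim
      case (elim \<omega>)
      then obtain z where "Phi z = P k \<omega> (Y (n + Suc k) \<omega>)"
        using Phi_surj by blast
      then have "P (Suc k) \<omega> = (\<lambda>t. (1 - rate k) * P k \<omega> t + rate k * copula_H \<rho> (P k \<omega> t) (Phi z))"
        using elim by (intro ext) (simp add: P_Suc)
      then show ?case
        using elim \<rho> rate_bounds[of k] regular_cdf_update[of "P k \<omega>" "rate k" \<rho> z] P_bounds[of \<omega> k]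
        by (simp add: less_imp_le)
    qed
  qed
  show "A \<in> sets (history k) \<Longrightarrow> 0 < v \<Longrightarrow> v < 1 \<Longrightarrow>
      prob (A \<inter> {\<omega> \<in> space M. P k \<omega> (Y (n + Suc k) \<omega>) < v}) = prob A * v"
    by (rule uniform_if[OF reg])
qed

section \<open>Bounded centred increments of the CDF at a fixed point\<close>

lemma increment_eq:
  "\<omega> \<in> space M \<Longrightarrow> increment y k \<omega>
     = rate k * (copula_H \<rho> (P k \<omega> y) (P k \<omega> (Y (n + Suc k) \<omega>)) - P k \<omega> y)"
  by (simp add: increment_def P_Suc algebra_simps)

lemma increment_bound:
  assumes "\<omega> \<in> space M"
  shows "\<bar>increment y k \<omega>\<bar> \<le> rate k"
proof -
  let ?H = "copula_H \<rho> (P k \<omega> y) (P k \<omega> (Y (n + Suc k) \<omega>))"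
  have "\<bar>?H - P k \<omega> y\<bar> \<le> 1"
    using P_bounds[OF assms, of k y] copula_H_nonneg[of \<rho> "P k \<omega> y" "P k \<omega> (Y (n + Suc k) \<omega>)"]
      copula_H_le_1[of \<rho> "P k \<omega> y" "P k \<omega> (Y (n + Suc k) \<omega>)"] by linarith
  then have "rate k * \<bar>?H - P k \<omega> y\<bar> \<le> rate k * 1"
    using rate_bounds[of k] by (intro mult_left_mono) auto
  then show ?thesis
    using rate_bounds[of k] by (simp add: increment_eq[OF assms] abs_mult)
qed

lemma increment_history: "increment y k \<in> borel_measurable (history (Suc k))"
  unfolding increment_def
  by (intro borel_measurable_diff P_history measurable_from_subalg[OF subalgebra_history_Suc P_history])

text \<open>Given the history, \<open>P k \<omega> y\<close> is known and the copula term averages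
  back to it, so the two conditional means cancel; \<open>rate k\<close> is deterministic and
  factors out.\<close>

lemma increment_centred: "AE \<omega> in M. real_cond_exp M (history k) (increment y k) \<omega> = 0"
proof -
  interpret finite_measure_subalgebra M "history k"
    by standard (rule subalgebra_history)
  let ?H = "\<lambda>\<omega>. copula_H \<rho> (P k \<omega> y) (P k \<omega> (Y (n + Suc k) \<omega>))"
  note [measurable] = P_M P_Y_M
  have H_int: "integrable M ?H"
    by (rule integrable_const_bound[where B = 1])
       (auto simp: copula_H_nonneg copula_H_le_1 intro!: borel_measurable_copula_H P_M P_Y_M simp del: add_Suc_right)
  have P_int: "integrable M (\<lambda>\<omega>. P k \<omega> y)"
    using P_bounds by (intro integrable_const_bound[where B = 1]) auto
  have "AE \<omega> in M. real_cond_exp M (history k) (increment y k) \<omega>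
      = real_cond_exp M (history k) (\<lambda>\<omega>. rate k * (?H \<omega> - P k \<omega> y)) \<omega>"
  proof (rule real_cond_exp_cong)
    show "AE \<omega> in M. increment y k \<omega> = rate k * (?H \<omega> - P k \<omega> y)"
      by (intro AE_I2 increment_eq)
    show "increment y k \<in> borel_measurable M"
      by (rule measurable_from_subalg[OF subalgebra_history increment_history])
    show "(\<lambda>\<omega>. rate k * (?H \<omega> - P k \<omega> y)) \<in> borel_measurable M"
      using H_int P_int by (intro borel_measurable_times borel_measurable_diff borel_measurable_const) auto
  qed
  moreover have "AE \<omega> in M. real_cond_exp M (history k) (\<lambda>\<omega>. rate k * (?H \<omega> - P k \<omega> y)) \<omega>
      = rate k * real_cond_exp M (history k) (\<lambda>\<omega>. ?H \<omega> - P k \<omega> y) \<omega>"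
    by (intro real_cond_exp_cmult Bochner_Integration.integrable_diff H_int P_int)
  moreover have "AE \<omega> in M. real_cond_exp M (history k) (\<lambda>\<omega>. ?H \<omega> - P k \<omega> y) \<omega>
      = real_cond_exp M (history k) ?H \<omega> - real_cond_exp M (history k) (\<lambda>\<omega>. P k \<omega> y) \<omega>"
    by (intro real_cond_exp_diff H_int P_int)
  moreover have "AE \<omega> in M. real_cond_exp M (history k) ?H \<omega> = P k \<omega> y"
    by (intro real_cond_exp_copula_H subalgebra_history P_Y_M uniform P_history P_bounds \<rho>)
  moreover have "AE \<omega> in M. real_cond_exp M (history k) (\<lambda>\<omega>. P k \<omega> y) \<omega> = P k \<omega> y"
    by (intro real_cond_exp_F_meas P_int P_history)
  ultimately show ?thesis
    by eventually_elim simp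
qed

lemma sum_increment: "\<omega> \<in> space M \<Longrightarrow> (\<Sum>k<N. increment y k \<omega>) = P N \<omega> y - P0 y"
  unfolding increment_def by (subst sum_lessThan_telescope) (simp add: initial)

lemma sum_rate_squared_le: "(\<Sum>k<N. (rate k)\<^sup>2) \<le> 2 powr (2 * \<beta>) * real n powr (1 - 2 * \<beta>) / (2 * \<beta> - 1)"
  unfolding rate_def by (rule sum_learning_rate_squared_le[OF n \<beta>])

section \<open>The almost sure limit and its deviation from the initial CDF\<close>

lemma AE_convergent_P: "AE \<omega> in M. convergent (\<lambda>N. P N \<omega> y)"
proof -
  have "summable (\<lambda>k. (rate k)\<^sup>2)"
    using sum_rate_squared_le by (intro summableI_nonneg_bounded) auto
  then have "AE \<omega> in M. convergent (\<lambda>N. \<Sum>k<N. increment y k \<omega>)"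
    by (intro AE_convergent_bounded_martingale_differences[where F = history and c = rate] subalgebra_history subalgebra_history_Suc
        increment_history rate_bounds increment_bound increment_centred)
  with AE_space show ?thesis
  proof eventually_elim
    case (elim \<omega>)
    then have "convergent (\<lambda>N. (P N \<omega> y - P0 y) + P0 y)"
      by (intro convergent_add convergent_const) (simp add: sum_increment)
    then show ?case
      by simp
  qed
qed

lemma prob_deviation_le:
  assumes "0 < \<epsilon>"
  shows "prob {\<omega> \<in> space M. \<exists>N. \<epsilon> \<le> \<bar>P N \<omega> y - P0 y\<bar>}
    \<le> 2 * exp (- \<epsilon>\<^sup>2 / (2 * (2 powr (2 * \<beta>) * real n powr (1 - 2 * \<beta>) / (2 * \<beta> - 1))))"
proof -
  have "{\<omega> \<in> space M. \<exists>N. \<epsilon> \<le> \<bar>P N \<omega> y - P0 y\<bar>} = {\<omega> \<in> space M. \<exists>N. \<epsilon> \<le> \<bar>\<Sum>k<N. increment y k \<omega>\<bar>}"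
    by (auto simp: sum_increment)
  also have "prob \<dots> \<le> 2 * exp (- \<epsilon>\<^sup>2 / (2 * (2 powr (2 * \<beta>) * real n powr (1 - 2 * \<beta>) / (2 * \<beta> - 1))))"
    using n \<beta> assms
    by (intro maximal_azuma[where F = history and c = rate] subalgebra_history subalgebra_history_Suc increment_history rate_bounds
        increment_bound increment_centred sum_rate_squared_le) auto
  finally show ?thesis .
qed

lemma borel_measurable_limit_cdf: "(\<lambda>\<omega>. limit_cdf P \<omega> y) \<in> borel_measurable M"
  unfolding limit_cdf_def by (intro borel_measurable_lim_metric P_M)

lemma limit_cdf_deviation:
  assumes \<delta>: "0 < \<delta>" "\<delta> < 1"
  shows "1 - \<delta> \<le> prob {\<omega> \<in> space M. \<bar>limit_cdf P \<omega> y - P0 y\<bar>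
    \<le> sqrt (2 powr (1 + 2 * \<beta>) * ln (2 / \<delta>) / (2 * \<beta> - 1)) * real n powr (- \<beta> + 1 / 2)}"
proof -
  \<comment> \<open>Solution of 2 exp (-\<epsilon>^2 / (2 s)) = \<delta>, that is \<epsilon>^2 = 2 s
    ln (2 / \<delta>): the factor 2 joins 2^(2 \<beta>) to form 2^(1 + 2 \<beta>), and n^(1 - 2
    \<beta>) has root n^(-\<beta> + 1/2).\<close>
  define \<epsilon> where "\<epsilon> = sqrt (2 powr (1 + 2 * \<beta>) * ln (2 / \<delta>) / (2 * \<beta> - 1)) * real n powr (- \<beta> + 1 / 2)"
  define s where "s = 2 powr (2 * \<beta>) * real n powr (1 - 2 * \<beta>) / (2 * \<beta> - 1)"
  have s: "0 < s"
    using n \<beta> by (simp add: s_def)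
  have ln: "0 < ln (2 / \<delta>)"
    using \<delta> by (intro ln_gt_zero) (simp add: field_simps)
  have \<epsilon>: "0 < \<epsilon>"
    unfolding \<epsilon>_def using n \<beta> ln by simp
  have "(real n powr (- \<beta> + 1 / 2))\<^sup>2 = real n powr (1 - 2 * \<beta>)"
    by (simp add: power2_eq_square flip: powr_add)
  then have "\<epsilon>\<^sup>2 = 2 * s * ln (2 / \<delta>)"
    unfolding \<epsilon>_def power_mult_distrib using ln \<beta> by (simp add: s_def powr_add)
  then have "- \<epsilon>\<^sup>2 / (2 * s) = - ln (2 / \<delta>)"
    using s by (simp add: field_simps)
  then have tail: "2 * exp (- \<epsilon>\<^sup>2 / (2 * s)) = \<delta>"
    using \<delta> by (simp add: exp_minus)
  let ?B = "{\<omega> \<in> space M. \<exists>N. \<epsilon> \<le> \<bar>P N \<omega> y - P0 y\<bar>}"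
  let ?G = "{\<omega> \<in> space M. \<bar>limit_cdf P \<omega> y - P0 y\<bar> \<le> \<epsilon>}"
  note [measurable] = P_M borel_measurable_limit_cdf
  have "1 - \<delta> \<le> 1 - prob ?B"
    using prob_deviation_le[OF \<epsilon>, of y] tail by (simp add: s_def)
  also have "\<dots> = prob (space M - ?B)"
    by (rule prob_compl[symmetric]) measurable
  \<comment> \<open>Off \<open>?B\<close> every \<open>P N\<close> stays strictly within
    \<open>\<epsilon>\<close> of \<open>P0\<close> at \<open>y\<close>, and the limit inherits the
    weak inequality. The inclusion is almost sure because \<open>lim\<close> is uncontrolled on
    divergent paths.\<close>
  also have "\<dots> \<le> prob ?G"
  proof (rule finite_measure_mono_AE)
    show "AE \<omega> in M. \<omega> \<in> space M - ?B \<longrightarrow> \<omega> \<in> ?G"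
      using AE_convergent_P[of y]
    proof (eventually_elim, intro impI)
      fix \<omega> assume conv: "convergent (\<lambda>N. P N \<omega> y)" and \<omega>: "\<omega> \<in> space M - ?B"
      have "(\<lambda>N. \<bar>P N \<omega> y - P0 y\<bar>) \<longlonglongrightarrow> \<bar>limit_cdf P \<omega> y - P0 y\<bar>"
        using conv unfolding limit_cdf_def convergent_LIMSEQ_iff by (intro tendsto_intros)
      then have "\<bar>limit_cdf P \<omega> y - P0 y\<bar> \<le> \<epsilon>"
        by (rule LIMSEQ_le_const2) (use \<omega> in \<open>auto simp: not_le intro: less_imp_le\<close>)
      then show "\<omega> \<in> ?G"
        using \<omega> by simp
    qed
  qed measurable
  finally show ?thesis
    by (simp add: \<epsilon>_def)
qed

end

text \<open>Almost sure convergence is part of the conclusion because \<open>limit_cdf\<close> rests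
  on \<open>lim\<close>, which is meaningful only on convergent paths.\<close>

theorem proposition3p3:
  fixes M :: "'a measure" and \<mu> :: "real measure"
    and n :: nat and \<rho> \<beta> y \<delta> :: real
    and Y :: "nat \<Rightarrow> 'a \<Rightarrow> real" and P :: "nat \<Rightarrow> 'a \<Rightarrow> real \<Rightarrow> real"
  assumes "n \<ge> 1" and "0 < \<rho>" and "\<rho> < 1" and "\<beta> > 1 / 2"
    and "real_distribution \<mu>" and "absolutely_continuous lborel \<mu>"
    and "gaussian_copula_forward_sampling M n \<rho> \<beta> (cdf \<mu>) Y P"
    and "0 < \<delta>" and "\<delta> < 1"
  shows "(AE \<omega> in M. convergent (\<lambda>N. P N \<omega> y)) \<and>
    measure M {\<omega> \<in> space M. \<bar>limit_cdf P \<omega> y - cdf \<mu> y\<bar>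
        \<le> sqrt (2 powr (1 + 2 * \<beta>) * ln (2 / \<delta>) / (2 * \<beta> - 1)) * real n powr (- \<beta> + 1 / 2)}
      \<ge> 1 - \<delta>"
proof -
  interpret \<mu>: real_distribution \<mu> by fact
  interpret gaussian_copula_forward_sampling M n \<rho> \<beta> "cdf \<mu>" Y P by fact
  have "mono (cdf \<mu>)"
    by (simp add: mono_def \<mu>.cdf_nondecreasing)
  moreover have "{0<..<1} \<subseteq> range (cdf \<mu>)"
    by (intro surj_onto_unit_interval isCont_cdf_absolutely_continuous assms
        \<mu>.cdf_lim_at_bot \<mu>.cdf_lim_at_top_prob)
  ultimately interpret regular_copula_sampling M n \<rho> \<beta> "cdf \<mu>" Y P
    using assms by unfold_locales (auto simp: \<mu>.cdf_nonneg \<mu>.cdf_bounded_prob)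
  show ?thesis
    using AE_convergent_P[of y] limit_cdf_deviation[of \<delta> y] assms by simp
qed

end
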